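(* Let $m$ be a positive integer and $\delta \in (-m,0)$. For integers $T\ge 2$ let $X(T, \delta, m)$ be the preferential attachment clique complex. Then: (i) for $q = 0$, $\beta_0(X(T, \delta, m)) \equiv 1$; (ii) for $q = 1$, $E[\beta_1(X(T, \delta, m))] = (m-1) T + o(T)$ as $T\to\infty$; (iii) for every nonnegative integer $q$ with $m < 2q$, $\beta_q(X(T, \delta, m)) \equiv 0$.
   Context: Preferential attachment graph: for integers $T\ge 2$, $m\ge 1$ and real $\delta>-m$, $G(T,\delta,m)$ is the random directed graph with no self-loops but possibly with repeated edges constructed inductively as follows. $G(2,\delta,m)$ is the deterministic graph with two nodes, indexed by $1$ and $2$, and $m$ edges from node $2$ to node $1$. $G(T,\delta,m)$ is constructed from $G(T-1,\delta,m)$ by adding a node with index $T$ and $m$ edges from node $T$ to randomly chosen nodes of $G(T-1,\delta,m)$, the edges being added one after another; for $1\le v\le T-1$, the probability that node $v$ is chosen as the endpoint of an edge is proportional to $\delta$ plus the (total) degree of node $v$, where the degree is updated every time an edge is added. Preferential attachment clique complex: let $G_{\text{simple}}(T,\delta,m)$ be the graph obtained from $G(T,\delta,m)$ by replacing all repeated edges with simple edges (directions are ignored). $X(T,\delta,m)$ is the clique complex of $G_{\text{simple}}(T,\delta,m)$, i.e. the simplicial complex whose simplices are the nonempty sets of nodes that are pairwise adjacent. $\beta_q(X)$ is the rank of the simplicial homology group $H_q(X)$ with coefficients in $\mathbb{Z}$ (unreduced). $E$ denotes expectation. The symbol $\equiv$ means that the random variable equals the constant for every realization of the random graph. $o(T)$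 denotes a quantity whose ratio to $T$ tends to $0$ as $T\to\infty$ (with $m,\delta$ fixed). *)

theory Defs
  imports "HOL-Probability.Probability" "HOL-Algebra.Free_Abelian_Groups"
    "HOL-Library.Landau_Symbols"
begin

text \<open>A directed multigraph is given by its multiset of edges, the pair \<open>(u, v)\<close> being an edge
  from \<open>u\<close> to \<open>v\<close>.\<close>

type_synonym multigraph = "(nat \<times> nat) multiset"

definition total_degree :: "multigraph \<Rightarrow> nat \<Rightarrow> nat" where
  "total_degree E v = size {#e \<in># E. fst e = v#} + size {#e \<in># E. snd e = v#}"

definition weighted_pmf :: "'a set \<Rightarrow> ('a \<Rightarrow> real) \<Rightarrow> 'a pmf" where
  "weighted_pmf A w = embed_pmf (\<lambda>x. if x \<in> A then w x / sum w A else 0)"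

text \<open>\<^const>\<open>embed_pmf\<close> is unspecified unless its argument is a probability mass function, so
  \<open>weighted_pmf\<close> is only meaningful in the following situation.\<close>

lemma pmf_weighted_pmf:
  assumes "finite A" "A \<noteq> {}" "\<And>x. x \<in> A \<Longrightarrow> w x > 0"
  shows "pmf (weighted_pmf A w) x = (if x \<in> A then w x / sum w A else 0)"
proof -
  have pos: "sum w A > 0"
    using assms by (intro sum_pos) auto
  have nonneg: "0 \<le> (if x \<in> A then w x / sum w A else 0)" for x
    using pos assms(3)[of x] by auto
  have "(\<integral>\<^sup>+x. ennreal (if x \<in> A then w x / sum w A else 0) \<partial>count_space UNIV)
      = (\<Sum>x\<in>A. ennreal (w x / sum w A))"
    by (subst nn_integral_count_space'[where A = A]) (use assms(1) in auto)
  also have "\<dots> = ennreal (\<Sum>x\<in>A. w x / sum w A)"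
    using nonneg by (intro sum_ennreal) (smt (verit))
  also have "(\<Sum>x\<in>A. w x / sum w A) = 1"
    using pos by (simp flip: sum_divide_distrib)
  finally show ?thesis
    unfolding weighted_pmf_def using nonneg by (subst pmf_embed_pmf) auto
qed

definition add_edge :: "real \<Rightarrow> nat \<Rightarrow> multigraph \<Rightarrow> multigraph pmf" where
  "add_edge \<delta> t E =
     map_pmf (\<lambda>v. add_mset (t, v) E)
       (weighted_pmf {1..t - 1} (\<lambda>v. \<delta> + real (total_degree E v)))"

primrec add_edges :: "nat \<Rightarrow> real \<Rightarrow> nat \<Rightarrow> multigraph \<Rightarrow> multigraph pmf" where
  "add_edges 0 \<delta> t E = return_pmf E"
| "add_edges (Suc k) \<delta> t E = bind_pmf (add_edges k \<delta> t E) (add_edge \<delta> t)"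

text \<open>The node set of \<open>pa_graph T \<delta> m\<close> is \<open>{1..T}\<close>; the values for \<open>T < 2\<close> are irrelevant.\<close>

primrec pa_graph :: "nat \<Rightarrow> real \<Rightarrow> nat \<Rightarrow> multigraph pmf" where
  "pa_graph 0 \<delta> m = return_pmf {#}"
| "pa_graph (Suc T) \<delta> m =
     (if T < 2 then return_pmf (replicate_mset m (2, 1))
      else bind_pmf (pa_graph T \<delta> m) (add_edges m \<delta> (Suc T)))"

text \<open>All weights used in the construction are positive: as long as \<open>\<delta> > - m\<close>, no node of a
  realization has total degree less than \<open>m\<close>, and degrees do not decrease when edges are added.\<close>

lemma filter_mset_replicate_mset:
  "filter_mset P (replicate_mset n x) = (if P x then replicate_mset n x else {#})"
  by (induction n) auto

lemma total_degree_add_edges: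
  assumes "E' \<in> set_pmf (add_edges k \<delta> t E)"
  shows "total_degree E v + (if v = t then k else 0) \<le> total_degree E' v"
  using assms
proof (induction k arbitrary: E')
  case (Suc k)
  then obtain E1 u where "E1 \<in> set_pmf (add_edges k \<delta> t E)" "E' = add_mset (t, u) E1"
    by (auto simp: add_edge_def)
  with Suc.IH[of E1] show ?case
    by (auto simp: total_degree_def split: if_splits)
qed simp

lemma total_degree_pa_graph:
  assumes "T \<ge> 2" "E \<in> set_pmf (pa_graph T \<delta> m)" "v \<in> {1..T}"
  shows "m \<le> total_degree E v"
  using assms
proof (induction T arbitrary: E v)
  case (Suc T)
  show ?case
  proof (cases "T < 2")
    case True
    with Suc.prems have "v = 1 \<or> v = 2" "E = replicate_mset m (2, 1)"
      by auto
    then show ?thesis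
      by (auto simp: total_degree_def filter_mset_replicate_mset)
  next
    case False
    with Suc.prems obtain E1 where E1: "E1 \<in> set_pmf (pa_graph T \<delta> m)"
      "E \<in> set_pmf (add_edges m \<delta> (Suc T) E1)"
      by auto
    show ?thesis
    proof (cases "v = Suc T")
      case True
      with total_degree_add_edges[OF E1(2), of v] show ?thesis by simp
    next
      case v: False
      with Suc.IH[OF _ E1(1), of v] Suc.prems False total_degree_add_edges[OF E1(2), of v]
      show ?thesis by simp
    qed
  qed
qed simp

definition simple_edges :: "('a \<times> 'a) multiset \<Rightarrow> 'a set set" where
  "simple_edges E = {{u, v} |u v. (u, v) \<in># E}"

definition clique_complex :: "'a set \<Rightarrow> 'a set set \<Rightarrow> 'a set set" where
  "clique_complex V F =
     {\<sigma>. finite \<sigma> \<and> \<sigma> \<noteq> {} \<and> \<sigma> \<subseteq> V \<and> (\<forall>u\<in>\<sigma>. \<forall>v\<in>\<sigma>. u \<noteq> v \<longrightarrow> {u, v} \<in> F)}"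

definition pa_clique_complex :: "nat \<Rightarrow> real \<Rightarrow> nat \<Rightarrow> nat set set pmf" where
  "pa_clique_complex T \<delta> m =
     map_pmf (\<lambda>E. clique_complex {1..T} (simple_edges E)) (pa_graph T \<delta> m)"

text \<open>Simplices are oriented by the linear order on the vertices: the \<open>i\<close>-th face of a simplex
  omits its \<open>i\<close>-th smallest vertex.\<close>

definition simplicial_chain_group ::
    "nat \<Rightarrow> 'a set set \<Rightarrow> ('a set \<Rightarrow>\<^sub>0 int) monoid" where
  "simplicial_chain_group q K = free_Abelian_group {\<sigma> \<in> K. finite \<sigma> \<and> card \<sigma> = Suc q}"

definition simplicial_boundary ::
    "nat \<Rightarrow> ('a::linorder set \<Rightarrow>\<^sub>0 int) \<Rightarrow> ('a set \<Rightarrow>\<^sub>0 int)" where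
  "simplicial_boundary q c =
     (if q = 0 then 0
      else frag_extend
        (\<lambda>\<sigma>. \<Sum>i\<le>q. frag_cmul ((-1) ^ i) (frag_of (\<sigma> - {sorted_list_of_set \<sigma> ! i}))) c)"

definition simplicial_cycles ::
    "nat \<Rightarrow> 'a::linorder set set \<Rightarrow> ('a set \<Rightarrow>\<^sub>0 int) set" where
  "simplicial_cycles q K =
     {c \<in> carrier (simplicial_chain_group q K). simplicial_boundary q c = 0}"

definition simplicial_boundaries ::
    "nat \<Rightarrow> 'a::linorder set set \<Rightarrow> ('a set \<Rightarrow>\<^sub>0 int) set" where
  "simplicial_boundaries q K =
     simplicial_boundary (Suc q) ` carrier (simplicial_chain_group (Suc q) K)"

definition simplicial_homology_group ::
    "nat \<Rightarrow> 'a::linorder set set \<Rightarrow> ('a set \<Rightarrow>\<^sub>0 int) set monoid" where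
  "simplicial_homology_group q K =
     subgroup_generated (simplicial_chain_group q K) (simplicial_cycles q K)
       Mod simplicial_boundaries q K"

definition int_independent :: "('a, 'b) monoid_scheme \<Rightarrow> 'a set \<Rightarrow> bool" where
  "int_independent G S \<longleftrightarrow>
     finite S \<and> S \<subseteq> carrier G \<and>
     (\<forall>c :: 'a \<Rightarrow> int.
        finprod G (\<lambda>x. x [^]\<^bsub>G\<^esub> c x) S = \<one>\<^bsub>G\<^esub> \<longrightarrow> (\<forall>x\<in>S. c x = 0))"

text \<open>The supremum of an unbounded set of natural numbers is unspecified, so the following is only
  meaningful for abelian groups of finite rank, such as the homology groups of finite complexes.\<close>

definition abelian_rank :: "('a, 'b) monoid_scheme \<Rightarrow> nat" where
  "abelian_rank G = Sup {card S |S. int_independent G S}"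

definition betti :: "nat \<Rightarrow> 'a::linorder set set \<Rightarrow> nat" where
  "betti q K = abelian_rank (simplicial_homology_group q K)"

end

theory Submission
  imports Defs "HOL-Real_Asymp.Real_Asymp"
begin

text \<open>In the clique complex every vertex has at most \<open>m\<close> smaller neighbours. A flag complex
  with fewer than \<open>2q\<close> vertices has no reduced homology in degree \<open>q - 1\<close> (the boundary of the
  cross-polytope is the smallest one that does), so for \<open>m < 2q\<close> coning off the lower link of the newest vertex never creates
  homology in degree \<open>q\<close>; hence (iii).

  For (ii), choose for every vertex one edge to an older vertex. This gives a spanning tree, and a
  1-cycle is determined by its coefficients on the other edges, of which there are at most
  \<open>(m - 1) (T - 1)\<close>. Conversely, the fundamental cycles of the edges that lie outside the tree
  and in no triangle are independent modulo boundaries. So \<open>\<beta>\<^sub>1\<close> differs from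
  \<open>(m - 1) (T - 1)\<close> by at most the number of repeated edges plus three times the number of
  triangles, and it remains to show that this defect has expectation \<open>o(T)\<close>.

  Let \<open>w\<^sub>v\<close> be \<open>m\<close> plus the in-degree of \<open>v\<close>. Since \<open>\<delta> < 0\<close>, the next edge chooses \<open>v\<close> with
  probability at most \<open>w\<^sub>v / ((2m + \<delta>) T - 2m)\<close>. Therefore the expected new defect at time \<open>T\<close> is
  \<open>O(P / T\<^sup>2)\<close> for the potential \<open>P\<close> combining the sum of \<open>w\<^sub>u w\<^sub>v\<close> over edges with a
  multiple \<open>K\<close> of the sum of \<open>w\<^sub>v\<^sup>2\<close> over vertices. The same bound on the probabilities shows that \<open>P\<close> grows in
  expectation at most like \<open>T\<^sup>a\<close> for any \<open>a\<close> larger than 1 and \<open>(2 + m/K) m / (2m + \<delta>)\<close>;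
  as \<open>2m / (2m + \<delta>) < 2\<close>, a large \<open>K\<close> allows \<open>a < 2\<close>.\<close>

section \<open>Rank of a quotient group\<close>

text \<open>Independence of classes in the quotient, phrased through representatives so that later
  arguments handle chains and never cosets.\<close>

definition independent_modulo ::
    "('a, 'b) monoid_scheme \<Rightarrow> 'a set \<Rightarrow> 'i set \<Rightarrow> ('i \<Rightarrow> 'a) \<Rightarrow> bool" where
  "independent_modulo G B I z \<longleftrightarrow>
     finite I \<and> z ` I \<subseteq> carrier G \<and>
     (\<forall>c :: 'i \<Rightarrow> int. finprod G (\<lambda>i. z i [^]\<^bsub>G\<^esub> c i) I \<in> B \<longrightarrow> (\<forall>i\<in>I. c i = 0))"

context comm_group
begin

lemma comm_group_Mod:
  assumes "subgroup B G"
  shows "comm_group (G Mod B)"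
  using assms abelian_FactGroup by blast

lemma coset_hom:
  assumes "subgroup B G"
  shows "group_hom G (G Mod B) (\<lambda>a. B #> a)"
proof -
  interpret N: normal B G
    using assms subgroup_imp_normal by blast
  interpret H: comm_group "G Mod B"
    using comm_group_Mod[OF assms] .
  show ?thesis
    by unfold_locales (rule N.r_coset_hom_Mod)
qed

lemma coset_eq_one_iff:
  assumes "subgroup B G" "a \<in> carrier G"
  shows "B #> a = \<one>\<^bsub>G Mod B\<^esub> \<longleftrightarrow> a \<in> B"
  using assms coset_join1 coset_join2 by (auto simp: FactGroup_def)

lemma finprod_coset:
  assumes "subgroup B G" "finite I" "z ` I \<subseteq> carrier G"
  shows "finprod (G Mod B) (\<lambda>i. (B #> z i) [^]\<^bsub>G Mod B\<^esub> (c i :: int)) I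
       = B #> finprod G (\<lambda>i. z i [^] c i) I"
proof -
  interpret H: comm_group "G Mod B"
    using comm_group_Mod[OF assms(1)] .
  interpret h: group_hom G "G Mod B" "\<lambda>a. B #> a"
    using coset_hom[OF assms(1)] .
  show ?thesis
    using assms(2,3)
  proof (induction I rule: finite_induct)
    case empty
    then show ?case using h.hom_one by simp
  next
    case (insert i I)
    have 1: "(\<lambda>i. (B #> z i) [^]\<^bsub>G Mod B\<^esub> c i) \<in> I \<rightarrow> carrier (G Mod B)"
      using insert.prems by (auto intro!: H.int_pow_closed h.hom_closed)
    have 2: "(\<lambda>i. z i [^] c i) \<in> I \<rightarrow> carrier G"
      using insert.prems by auto
    have 3: "z i \<in> carrier G" using insert.prems by auto
    have "finprod (G Mod B) (\<lambda>i. (B #> z i) [^]\<^bsub>G Mod B\<^esub> c i) (insert i I)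
        = (B #> z i) [^]\<^bsub>G Mod B\<^esub> c i \<otimes>\<^bsub>G Mod B\<^esub> (B #> finprod G (\<lambda>i. z i [^] c i) I)"
      using insert 1 3 by (subst H.finprod_insert) (auto intro!: H.int_pow_closed h.hom_closed)
    also have "\<dots> = B #> (z i [^] c i \<otimes> finprod G (\<lambda>i. z i [^] c i) I)"
      using h.hom_mult[of "z i [^] c i" "finprod G (\<lambda>i. z i [^] c i) I"]
            h.hom_int_pow[OF 3, of "c i"] 2 3 by (simp add: finprod_closed)
    also have "\<dots> = B #> finprod G (\<lambda>i. z i [^] c i) (insert i I)"
      using insert 2 3 by simp
    finally show ?case .
  qed
qed

text \<open>The cosets in \<open>S\<close> serve as indices of their own representatives.\<close>

lemma int_independent_Mod_imp:
  assumes "subgroup B G" "int_independent (G Mod B) S"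
  obtains r where "independent_modulo G B S r"
proof -
  have S: "finite S" "S \<subseteq> carrier (G Mod B)"
    using assms(2) by (auto simp: int_independent_def)
  have "\<forall>s\<in>S. \<exists>a. a \<in> carrier G \<and> s = B #> a"
    using S(2) by (auto simp: FactGroup_def RCOSETS_def)
  then obtain r where r: "\<And>s. s \<in> S \<Longrightarrow> r s \<in> carrier G" "\<And>s. s \<in> S \<Longrightarrow> s = B #> r s"
    by metis
  interpret H: comm_group "G Mod B"
    using comm_group_Mod[OF assms(1)] .
  have "\<forall>s\<in>S. c s = 0" if "finprod G (\<lambda>i. r i [^] c i) S \<in> B" for c :: "'a set \<Rightarrow> int"
  proof -
    have pow: "s [^]\<^bsub>G Mod B\<^esub> c s \<in> carrier (G Mod B)" if "s \<in> S" for s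
      using that S(2) by (intro H.int_pow_closed) auto
    have "finprod (G Mod B) (\<lambda>s. s [^]\<^bsub>G Mod B\<^esub> c s) S
        = finprod (G Mod B) (\<lambda>s. (B #> r s) [^]\<^bsub>G Mod B\<^esub> c s) S"
      using r pow by (intro H.finprod_cong') (auto simp flip: r(2))
    also have "\<dots> = B #> finprod G (\<lambda>i. r i [^] c i) S"
      using r S by (intro finprod_coset assms(1)) auto
    also have "\<dots> = \<one>\<^bsub>G Mod B\<^esub>"
      using that r by (subst coset_eq_one_iff) (auto intro!: assms(1) finprod_closed)
    finally show ?thesis
      using assms(2) by (auto simp: int_independent_def)
  qed
  then have "independent_modulo G B S r"
    using S r by (auto simp: independent_modulo_def)
  then show ?thesis by (rule that)
qed

lemma independent_modulo_imp:
  assumes "subgroup B G" "independent_modulo G B I z"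
  shows "inj_on (\<lambda>i. B #> z i) I" "int_independent (G Mod B) ((\<lambda>i. B #> z i) ` I)"
proof -
  have I: "finite I" "z ` I \<subseteq> carrier G"
    and ind: "\<And>c::_ \<Rightarrow> int. finprod G (\<lambda>i. z i [^] c i) I \<in> B \<Longrightarrow> \<forall>i\<in>I. c i = 0"
    using assms(2) by (auto simp: independent_modulo_def)
  interpret H: comm_group "G Mod B"
    using comm_group_Mod[OF assms(1)] .
  interpret h: group_hom G "G Mod B" "\<lambda>a. B #> a"
    using coset_hom[OF assms(1)] .
  show inj: "inj_on (\<lambda>i. B #> z i) I"
  proof (rule inj_onI, rule ccontr)
    fix i j assume ij: "i \<in> I" "j \<in> I" "B #> z i = B #> z j" "i \<noteq> j"
    then have "z i \<in> carrier G" "z j \<in> carrier G"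
      using I by auto
    \<comment> \<open>Equal cosets at two indices would give the relation with coefficients 1 and
      -1, which independence forbids.\<close>
    define c where "c k = (if k = i then 1 else if k = j then -1 else (0::int))" for k
    have "finprod G (\<lambda>k. z k [^] c k) I = finprod G (\<lambda>k. z k [^] c k) {i, j}"
      using ij I by (intro finprod_mono_neutral_cong_right) (auto simp: c_def)
    also have "\<dots> = z i \<otimes> inv (z j)"
      using ij \<open>z i \<in> carrier G\<close> \<open>z j \<in> carrier G\<close> by (simp add: c_def int_pow_neg)
    also have "B #> (z i \<otimes> inv (z j)) = \<one>\<^bsub>G Mod B\<^esub>"
    proof -
      have zij: "z i \<in> carrier G" "z j \<in> carrier G"
        using I ij by auto
      then have "B #> (z i \<otimes> inv (z j)) = (B #> z i) \<otimes>\<^bsub>G Mod B\<^esub> (B #> inv (z j))"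
        using h.hom_mult by simp
      also have "\<dots> = (B #> z j) \<otimes>\<^bsub>G Mod B\<^esub> inv\<^bsub>G Mod B\<^esub> (B #> z j)"
        using ij(3) h.hom_inv[OF zij(2)] by simp
      also have "\<dots> = \<one>\<^bsub>G Mod B\<^esub>"
        using h.hom_closed[OF zij(2)] by (rule H.r_inv)
      finally show ?thesis .
    qed
    then have "z i \<otimes> inv (z j) \<in> B"
      using \<open>z i \<in> carrier G\<close> \<open>z j \<in> carrier G\<close> by (subst (asm) coset_eq_one_iff[OF assms(1)]) auto
    finally have "c i = 0" using ind ij by blast
    then show False by (simp add: c_def)
  qed
  have "\<forall>s\<in>(\<lambda>i. B #> z i) ` I. c s = 0"
    if c: "finprod (G Mod B) (\<lambda>s. s [^]\<^bsub>G Mod B\<^esub> c s) ((\<lambda>i. B #> z i) ` I) = \<one>\<^bsub>G Mod B\<^esub>"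
    for c :: "'a set \<Rightarrow> int"
  proof -
    have "B #> finprod G (\<lambda>i. z i [^] c (B #> z i)) I
        = finprod (G Mod B) (\<lambda>i. (B #> z i) [^]\<^bsub>G Mod B\<^esub> c (B #> z i)) I"
      using I by (intro finprod_coset[symmetric] assms(1)) auto
    also have "\<dots> = finprod (G Mod B) (\<lambda>s. s [^]\<^bsub>G Mod B\<^esub> c s) ((\<lambda>i. B #> z i) ` I)"
      using I inj by (intro H.finprod_reindex[symmetric])
        (auto intro!: H.int_pow_closed h.hom_closed)
    finally have eq: "B #> finprod G (\<lambda>i. z i [^] c (B #> z i)) I = \<one>\<^bsub>G Mod B\<^esub>"
      using c by simp
    have "finprod G (\<lambda>i. z i [^] c (B #> z i)) I \<in> carrier G"
      using I by (intro finprod_closed) auto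
    then have "finprod G (\<lambda>i. z i [^] c (B #> z i)) I \<in> B"
      using eq coset_eq_one_iff[OF assms(1)] by blast
    then show ?thesis using ind[of "\<lambda>i. c (B #> z i)"] by blast
  qed
  then show "int_independent (G Mod B) ((\<lambda>i. B #> z i) ` I)"
    using I by (auto simp: int_independent_def intro!: h.hom_closed)
qed

text \<open>The empty family is independent, so the supremum is taken over a non-empty set and every
  upper bound dominates it.\<close>

lemma abelian_rank_Mod_le:
  assumes "subgroup B G"
    and "\<And>(S :: 'a set set) r. independent_modulo G B S r \<Longrightarrow> card S \<le> n"
  shows "abelian_rank (G Mod B) \<le> n"
proof -
  have "int_independent (G Mod B) {}"
    by (simp add: int_independent_def)
  then show ?thesis
    unfolding abelian_rank_def
    by (intro cSup_least) (blast, auto elim!: int_independent_Mod_imp[OF assms(1)] dest: assms(2))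
qed

text \<open>A lower bound for the rank takes an upper bound \<open>n\<close> along: a supremum of
  naturals dominates its members only if the set is bounded.\<close>

lemma abelian_rank_Mod_ge:
  assumes "subgroup B G"
    and "\<And>(S :: 'a set set) r. independent_modulo G B S r \<Longrightarrow> card S \<le> n"
    and "independent_modulo G B I z"
  shows "card I \<le> abelian_rank (G Mod B)"
proof -
  have "card I = card ((\<lambda>i. B #> z i) ` I)"
    using independent_modulo_imp[OF assms(1,3)] by (simp add: card_image)
  moreover have "bdd_above {card S |S. int_independent (G Mod B) S}"
    by (rule bdd_aboveI[of _ n]) (auto elim!: int_independent_Mod_imp[OF assms(1)] dest: assms(2))
  ultimately show ?thesis
    unfolding abelian_rank_def using independent_modulo_imp(2)[OF assms(1,3)]
    by (intro cSup_upper) auto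
qed

end

section \<open>Augmented simplicial chains\<close>

text \<open>Summing up to \<open>card \<sigma>\<close> instead of a fixed degree gives a vertex the
  empty simplex as its face, which makes the boundary augmented.\<close>

definition faces :: "'a::linorder set \<Rightarrow> ('a set \<Rightarrow>\<^sub>0 int)" where
  "faces \<sigma> = (\<Sum>i<card \<sigma>. frag_cmul ((-1) ^ i) (frag_of (\<sigma> - {sorted_list_of_set \<sigma> ! i})))"

text \<open>Chains may involve the empty simplex, so the cycles of this boundary are those of reduced
  homology.\<close>

definition augmented_boundary :: "('a::linorder set \<Rightarrow>\<^sub>0 int) \<Rightarrow> ('a set \<Rightarrow>\<^sub>0 int)" where
  "augmented_boundary = frag_extend faces"

text \<open>There is no sign because the joined vertex is larger than all vertices of the chain
  whenever its boundary is computed.\<close>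

definition join_vertex :: "'a \<Rightarrow> ('a set \<Rightarrow>\<^sub>0 int) \<Rightarrow> ('a set \<Rightarrow>\<^sub>0 int)" where
  "join_vertex v = frag_extend (\<lambda>\<sigma>. frag_of (insert v \<sigma>))"

text \<open>Records the simplices through \<open>v\<close> by their faces opposite \<open>v\<close>;
  with \<open>antistar_part\<close> for the simplices avoiding \<open>v\<close> it splits a
  chain.\<close>

definition link_part :: "'a \<Rightarrow> ('a set \<Rightarrow>\<^sub>0 int) \<Rightarrow> ('a set \<Rightarrow>\<^sub>0 int)" where
  "link_part v = frag_extend (\<lambda>\<sigma>. if v \<in> \<sigma> then frag_of (\<sigma> - {v}) else 0)"

definition antistar_part :: "'a \<Rightarrow> ('a set \<Rightarrow>\<^sub>0 int) \<Rightarrow> ('a set \<Rightarrow>\<^sub>0 int)" where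
  "antistar_part v = frag_extend (\<lambda>\<sigma>. if v \<in> \<sigma> then 0 else frag_of \<sigma>)"

lemmas frag_linear = frag_extend_diff frag_extend_add frag_extend_minus frag_extend_cmul

lemma augmented_boundary_simps [simp]:
  "augmented_boundary 0 = 0"
  "augmented_boundary (a - b) = augmented_boundary a - augmented_boundary b"
  "augmented_boundary (a + b) = augmented_boundary a + augmented_boundary b"
  "augmented_boundary (- a) = - augmented_boundary a"
  "augmented_boundary (frag_cmul k a) = frag_cmul k (augmented_boundary a)"
  "augmented_boundary (frag_of \<sigma>) = faces \<sigma>"
  by (simp_all add: augmented_boundary_def frag_linear)

lemma join_vertex_simps [simp]:
  "join_vertex v 0 = 0" "join_vertex v (a - b) = join_vertex v a - join_vertex v b" "join_vertex v (a + b) = join_vertex v a + join_vertex v b"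
  "join_vertex v (frag_cmul k a) = frag_cmul k (join_vertex v a)"
  "join_vertex v (frag_of \<sigma>) = frag_of (insert v \<sigma>)"
  by (simp_all add: join_vertex_def frag_linear)

lemma frag_cmul_diff: "frag_cmul k (a - b) = frag_cmul k a - frag_cmul k b"
  using frag_cmul_distrib2[of k "a - b" b] by simp

lemma keys_sumI:
  "(\<And>i. i \<in> I \<Longrightarrow> Poly_Mapping.keys (f i) \<subseteq> A) \<Longrightarrow> Poly_Mapping.keys (sum f I) \<subseteq> A"
  using keys_sum[of f I] by blast

lemma keys_addI:
  "Poly_Mapping.keys a \<subseteq> A \<Longrightarrow> Poly_Mapping.keys b \<subseteq> A \<Longrightarrow> Poly_Mapping.keys (a + b) \<subseteq> A"
  using keys_add[of a b] by blast

lemma keys_diffI: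
  "Poly_Mapping.keys a \<subseteq> A \<Longrightarrow> Poly_Mapping.keys b \<subseteq> A \<Longrightarrow> Poly_Mapping.keys (a - b) \<subseteq> A"
  using keys_diff[of a b] by blast

lemma keys_faces: "Poly_Mapping.keys (faces \<sigma>) \<subseteq> {\<sigma> - {v} |v. v \<in> \<sigma>}"
proof (cases "finite \<sigma>")
  case True
  have "sorted_list_of_set \<sigma> ! i \<in> \<sigma>" if "i < card \<sigma>" for i
    using that True nth_mem[of i "sorted_list_of_set \<sigma>"] by simp
  then show ?thesis
    unfolding faces_def by (intro keys_sumI order.trans[OF keys_cmul]) auto
qed (simp add: faces_def)

lemma keys_augmented_boundary:
  "Poly_Mapping.keys (augmented_boundary c) \<subseteq> {\<sigma> - {v} |\<sigma> v. \<sigma> \<in> Poly_Mapping.keys c \<and> v \<in> \<sigma>}"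
  unfolding augmented_boundary_def
proof -
  have "Poly_Mapping.keys (faces \<sigma>) \<subseteq> {\<sigma> - {v} |\<sigma> v. \<sigma> \<in> Poly_Mapping.keys c \<and> v \<in> \<sigma>}"
    if "\<sigma> \<in> Poly_Mapping.keys c" for \<sigma>
    using that keys_faces[of \<sigma>] by blast
  then show "Poly_Mapping.keys (frag_extend faces c)
      \<subseteq> {\<sigma> - {v} |\<sigma> v. \<sigma> \<in> Poly_Mapping.keys c \<and> v \<in> \<sigma>}"
    by (intro order.trans[OF keys_frag_extend] UN_least)
qed

lemma keys_join_vertex: "Poly_Mapping.keys (join_vertex v c) \<subseteq> insert v ` Poly_Mapping.keys c"
  unfolding join_vertex_def using keys_frag_extend[of "\<lambda>\<sigma>. frag_of (insert v \<sigma>)" c] by auto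

lemma keys_link_part:
  "Poly_Mapping.keys (link_part v c) \<subseteq> {\<sigma> - {v} |\<sigma>. \<sigma> \<in> Poly_Mapping.keys c \<and> v \<in> \<sigma>}"
  unfolding link_part_def
  by (rule order.trans[OF keys_frag_extend]) (auto split: if_splits)

lemma keys_antistar_part:
  "Poly_Mapping.keys (antistar_part v c) \<subseteq> {\<sigma> \<in> Poly_Mapping.keys c. v \<notin> \<sigma>}"
  unfolding antistar_part_def
  by (rule order.trans[OF keys_frag_extend]) (auto split: if_splits)

lemma link_antistar_decomposition: "c = join_vertex v (link_part v c) + antistar_part v c"
proof -
  have "Poly_Mapping.keys c \<subseteq> UNIV" by simp
  then show ?thesis
  proof (induction c rule: frag_induction)
    case (diff a b)
    have "join_vertex v (link_part v (a - b)) + antistar_part v (a - b)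
        = (join_vertex v (link_part v a) + antistar_part v a) - (join_vertex v (link_part v b) + antistar_part v b)"
      by (simp add: link_part_def antistar_part_def frag_extend_diff)
    also have "\<dots> = a - b"
      by (simp only: diff(1)[symmetric] diff(2)[symmetric])
    finally show ?case by simp
  qed (auto simp: link_part_def antistar_part_def insert_absorb)
qed

lemma link_part_join_vertex:
  assumes "\<And>\<sigma>. \<sigma> \<in> Poly_Mapping.keys c \<Longrightarrow> v \<notin> \<sigma>"
  shows "link_part v (join_vertex v c) = c"
proof -
  have "Poly_Mapping.keys c \<subseteq> {\<sigma>. v \<notin> \<sigma>}" using assms by auto
  then show ?thesis
    by (induction c rule: frag_induction) (auto simp: link_part_def frag_extend_diff)
qed

lemma link_part_eq_0:
  assumes "\<And>\<sigma>. \<sigma> \<in> Poly_Mapping.keys c \<Longrightarrow> v \<notin> \<sigma>"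
  shows "link_part v c = 0"
  unfolding link_part_def using assms by (intro frag_extend_eq_0) auto

text \<open>Simplices of the join contain \<open>v\<close> and those of \<open>b\<close> do not, so
  nothing cancels and \<open>link_part\<close> recovers \<open>a\<close>.\<close>

lemma join_vertex_add_eq_0_iff:
  assumes "\<And>\<sigma>. \<sigma> \<in> Poly_Mapping.keys a \<union> Poly_Mapping.keys b \<Longrightarrow> v \<notin> \<sigma>"
  shows "join_vertex v a + b = 0 \<longleftrightarrow> a = 0 \<and> b = 0"
proof -
  have "link_part v (join_vertex v a + b) = a"
    using link_part_join_vertex[of a v] link_part_eq_0[of b v] assms
    by (simp add: link_part_def frag_extend_add)
  then show ?thesis by (auto simp: link_part_def)
qed

text \<open>Since \<open>v\<close> is last in the vertex order, omitting another vertex keeps its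
  position and sign, and omitting \<open>v\<close> carries the index
  \<open>card \<sigma>\<close>.\<close>

lemma faces_insert_max:
  assumes "finite \<sigma>" "\<And>u. u \<in> \<sigma> \<Longrightarrow> u < v"
  shows "faces (insert v \<sigma>) = join_vertex v (faces \<sigma>) + frag_cmul ((-1) ^ card \<sigma>) (frag_of \<sigma>)"
proof -
  let ?s = "sorted_list_of_set \<sigma>"
  have v: "v \<notin> \<sigma>" using assms(2) by blast
  have list: "sorted_list_of_set (insert v \<sigma>) = ?s @ [v]"
    using assms v by (simp add: sorted_insort_is_snoc less_imp_le)
  have "faces (insert v \<sigma>) = (\<Sum>i<card \<sigma>. frag_cmul ((-1) ^ i) (frag_of (insert v \<sigma> - {(?s @ [v]) ! i})))
        + frag_cmul ((-1) ^ card \<sigma>) (frag_of (insert v \<sigma> - {(?s @ [v]) ! card \<sigma>}))"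
    unfolding faces_def list using assms(1) v by simp
  also have "(\<Sum>i<card \<sigma>. frag_cmul ((-1) ^ i) (frag_of (insert v \<sigma> - {(?s @ [v]) ! i})))
      = (\<Sum>i<card \<sigma>. join_vertex v (frag_cmul ((-1) ^ i) (frag_of (\<sigma> - {?s ! i}))))"
  proof (rule sum.cong)
    fix i assume "i \<in> {..<card \<sigma>}"
    then have "(?s @ [v]) ! i = ?s ! i" "?s ! i \<noteq> v"
      using assms(1) v nth_mem[of i ?s] by (auto simp: nth_append)
    then show "frag_cmul ((-1) ^ i) (frag_of (insert v \<sigma> - {(?s @ [v]) ! i}))
        = join_vertex v (frag_cmul ((-1) ^ i) (frag_of (\<sigma> - {?s ! i})))"
      by (simp add: insert_Diff_if)
  qed simp
  also have "\<dots> = join_vertex v (faces \<sigma>)"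
    unfolding faces_def join_vertex_def by (subst frag_extend_sum) (auto simp: o_def)
  also have "insert v \<sigma> - {(?s @ [v]) ! card \<sigma>} = \<sigma>"
    using v assms(1) by (simp add: nth_append)
  finally show ?thesis .
qed

lemma augmented_boundary_join_vertex:
  assumes "\<And>\<sigma>. \<sigma> \<in> Poly_Mapping.keys c \<Longrightarrow> finite \<sigma> \<and> card \<sigma> = n \<and> (\<forall>u\<in>\<sigma>. u < v)"
  shows "augmented_boundary (join_vertex v c) = join_vertex v (augmented_boundary c) + frag_cmul ((-1) ^ n) c"
proof -
  have "Poly_Mapping.keys c \<subseteq> {\<sigma>. finite \<sigma> \<and> card \<sigma> = n \<and> (\<forall>u\<in>\<sigma>. u < v)}"
    using assms by auto
  then show ?thesis
    by (induction c rule: frag_induction) (auto simp: faces_insert_max frag_cmul_diff)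
qed

text \<open>Induction on the largest vertex: the cone formula yields the faces of the smaller
  simplex twice, with opposite signs.\<close>

lemma augmented_boundary_faces:
  assumes "finite \<sigma>"
  shows "augmented_boundary (faces \<sigma>) = 0"
  using assms
proof (induction \<sigma> rule: finite_linorder_max_induct)
  case empty
  then show ?case by (simp add: faces_def)
next
  case (insert v \<sigma>)
  have "v \<notin> \<sigma>" using insert by blast
  show ?case
  proof (cases "\<sigma> = {}")
    case True
    then show ?thesis by (simp add: faces_def)
  next
    case False
    then obtain n where n: "card \<sigma> = Suc n"
      using insert by (metis card_eq_0_iff not0_implies_Suc)
    have "augmented_boundary (join_vertex v (faces \<sigma>))
        = join_vertex v (augmented_boundary (faces \<sigma>)) + frag_cmul ((-1) ^ n) (faces \<sigma>)"
      using insert n keys_faces[of \<sigma>] by (intro augmented_boundary_join_vertex) auto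
    then show ?thesis
      using insert n by (simp add: faces_insert_max flip: minus_frag_cmul)
  qed
qed

lemma augmented_boundary_boundary:
  assumes "\<And>\<sigma>. \<sigma> \<in> Poly_Mapping.keys c \<Longrightarrow> finite \<sigma>"
  shows "augmented_boundary (augmented_boundary c) = 0"
proof -
  have "Poly_Mapping.keys c \<subseteq> {\<sigma>. finite \<sigma>}" using assms by auto
  then show ?thesis
    by (induction c rule: frag_induction) (auto simp: augmented_boundary_faces)
qed

section \<open>Acyclicity of flag complexes\<close>

text \<open>Unlike \<open>clique_complex\<close>, this contains the empty set at
  \<open>n = 0\<close>, the augmentation simplex of reduced homology.\<close>

definition cliques :: "'a set \<Rightarrow> 'a set set \<Rightarrow> nat \<Rightarrow> 'a set set" where
  "cliques V F n =
     {\<sigma>. finite \<sigma> \<and> card \<sigma> = n \<and> \<sigma> \<subseteq> V \<and> (\<forall>u\<in>\<sigma>. \<forall>v\<in>\<sigma>. u \<noteq> v \<longrightarrow> {u, v} \<in> F)}"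

definition lower_nbrs :: "'a::linorder set \<Rightarrow> 'a set set \<Rightarrow> 'a \<Rightarrow> 'a set" where
  "lower_nbrs V F v = {u \<in> V. u < v \<and> {u, v} \<in> F}"

text \<open>The number \<open>n\<close> counts the vertices of a simplex, so \<open>c\<close> has degree \<open>n - 1\<close>. The first
  alternative in the hypothesis is what makes it pass to the lower link of the largest vertex: in a
  set of fewer than \<open>2(n - 1)\<close> vertices, a vertex that misses some smaller vertex has fewer than
  \<open>2(n - 2)\<close> smaller neighbours.\<close>

lemma flag_cycle_bounds:
  assumes "finite (V :: 'a::linorder set)" "n > 0"
    and "\<And>v. v \<in> V \<Longrightarrow> lower_nbrs V F v = {u \<in> V. u < v} \<or> card (lower_nbrs V F v) < 2 * (n - 1)"
    and "Poly_Mapping.keys c \<subseteq> cliques V F n" "augmented_boundary c = 0"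
  shows "\<exists>e. Poly_Mapping.keys e \<subseteq> cliques V F (Suc n) \<and> augmented_boundary e = c"
  using assms
proof (induction "card V" arbitrary: V n c rule: less_induct)
  case less
  show ?case
  proof (cases "V = {}")
    case True
    then have "cliques V F n = {}"
      using less.prems(2) by (auto simp: cliques_def)
    then have "c = 0"
      using less.prems(4) by simp
    then show ?thesis by (intro exI[of _ 0]) auto
  next
    case False
    define v where "v = Max V"
    have v: "v \<in> V" "\<And>u. u \<in> V \<Longrightarrow> u \<noteq> v \<Longrightarrow> u < v"
      using less.prems(1) False Max_ge[of V] by (auto simp: v_def order_less_le)
    \<comment> \<open>Since \<open>v\<close> is the largest vertex, its link is spanned by its
      smaller neighbours: \<open>c\<close> is the join of \<open>v\<close> with a chain
      \<open>d\<close> on \<open>N\<close>, plus a chain \<open>a\<close> avoiding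
      \<open>v\<close>.\<close>
    define d where "d = link_part v c"
    define a where "a = antistar_part v c"
    define N where "N = lower_nbrs V F v"
    have N: "N \<subseteq> V - {v}" "finite N"
      using less.prems(1) by (auto simp: N_def lower_nbrs_def)
    have c: "c = join_vertex v d + a"
      unfolding d_def a_def by (rule link_antistar_decomposition)
    have keys_a: "Poly_Mapping.keys a \<subseteq> cliques (V - {v}) F n"
      using keys_antistar_part[of v c] less.prems(4) by (auto simp: a_def cliques_def)
    have keys_d: "Poly_Mapping.keys d \<subseteq> cliques N F (n - 1)"
    proof
      fix \<tau> assume "\<tau> \<in> Poly_Mapping.keys d"
      then obtain \<sigma> where \<sigma>: "\<sigma> \<in> cliques V F n" "v \<in> \<sigma>" "\<tau> = \<sigma> - {v}"
        using keys_link_part[of v c] less.prems(4) unfolding d_def by blast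
      then have "u \<in> N" if "u \<in> \<tau>" for u
        using that v by (auto simp: cliques_def N_def lower_nbrs_def)
      then show "\<tau> \<in> cliques N F (n - 1)"
        using \<sigma> by (auto simp: cliques_def card_Diff_singleton)
    qed
    have card_N: "card N < card V"
      using N less.prems(1) v(1) by (intro psubset_card_mono) auto
    have card_V': "card (V - {v}) < card V"
      using less.prems(1) v(1) by (rule card_Diff1_less)
    have bd_join: "augmented_boundary (join_vertex v x) = join_vertex v (augmented_boundary x) + frag_cmul ((-1) ^ k) x"
      if "Poly_Mapping.keys x \<subseteq> cliques (V - {v}) F k" for x k
      using that v(2) by (intro augmented_boundary_join_vertex) (auto simp: cliques_def)
    have N_V': "cliques N F k \<subseteq> cliques (V - {v}) F k" for k
      using N by (auto simp: cliques_def)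
    have join_clique: "Poly_Mapping.keys (join_vertex v x) \<subseteq> cliques V F (Suc k)"
      if "Poly_Mapping.keys x \<subseteq> cliques N F k" for x k
    proof -
      have "insert v \<sigma> \<in> cliques V F (Suc k)" if "\<sigma> \<in> cliques N F k" for \<sigma>
      proof -
        have "v \<notin> \<sigma>" "\<sigma> \<subseteq> V" "\<forall>u\<in>\<sigma>. {u, v} \<in> F"
          using that N by (auto simp: cliques_def N_def lower_nbrs_def)
        then show ?thesis
          using that v(1) by (auto simp: cliques_def insert_commute)
      qed
      then show ?thesis
        using keys_join_vertex[of v x] that by blast
    qed
    have avoid_a: "v \<notin> \<sigma>" if "\<sigma> \<in> Poly_Mapping.keys a" for \<sigma>
      using that keys_a unfolding cliques_def by blast
    have avoid_d: "v \<notin> \<sigma>" if "\<sigma> \<in> Poly_Mapping.keys d" for \<sigma>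
      using that keys_d N unfolding cliques_def by blast
    have avoid_bd: "v \<notin> \<sigma>"
      if "\<sigma> \<in> Poly_Mapping.keys (augmented_boundary x)" "\<And>\<tau>. \<tau> \<in> Poly_Mapping.keys x \<Longrightarrow> v \<notin> \<tau>" for x \<sigma>
      using that keys_augmented_boundary[of x] by blast
    have avoid: "v \<notin> \<sigma>"
      if "\<sigma> \<in> Poly_Mapping.keys (augmented_boundary d) \<union> Poly_Mapping.keys (frag_cmul k d + augmented_boundary a)" for \<sigma> k
      using that avoid_bd[of \<sigma> a] avoid_bd[of \<sigma> d] avoid_a avoid_d
        keys_add[of "frag_cmul k d" "augmented_boundary a"] keys_cmul[of k d] by blast
    \<comment> \<open>The simplices through \<open>v\<close> and those avoiding it vanish
      separately: \<open>d\<close> is a cycle, and \<open>a\<close> has boundary \<open>d\<close> up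
      to sign.\<close>
    have "0 = join_vertex v (augmented_boundary d) + (frag_cmul ((-1) ^ (n - 1)) d + augmented_boundary a)"
      using less.prems(5) bd_join[OF order.trans[OF keys_d N_V']] by (simp add: c add.assoc)
    then have bd: "augmented_boundary d = 0" "frag_cmul ((-1) ^ (n - 1)) d + augmented_boundary a = 0"
      using join_vertex_add_eq_0_iff[of "augmented_boundary d" "frag_cmul ((-1) ^ (n - 1)) d + augmented_boundary a" v]
        avoid by metis+
    obtain k where n: "n = Suc k"
      using less.prems(2) by (cases n) auto
    show ?thesis
    proof (cases "N = {u \<in> V. u < v}")
      case True
      then have N_eq: "N = V - {v}"
        using v(2) by auto
      \<comment> \<open>Here \<open>v\<close> is adjacent to all other vertices, so the complex is a
        cone and the join of \<open>v\<close> with \<open>a\<close>, suitably signed, fills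
        \<open>c\<close>.\<close>
      define e where "e = frag_cmul ((-1) ^ n) (join_vertex v a)"
      have d_eq: "d = frag_cmul ((-1) ^ n) (augmented_boundary a)"
      proof -
        have "d = frag_cmul ((-1) ^ k) (frag_cmul ((-1) ^ k) d)"
          by (simp flip: power_mult_distrib)
        also have "frag_cmul ((-1) ^ k) d = - augmented_boundary a"
          using bd(2) n by (simp add: add_eq_0_iff2)
        finally show ?thesis
          using n by (simp flip: frag_cmul_minus_one)
      qed
      have "augmented_boundary e = c"
        using bd_join[OF keys_a] by (simp add: e_def c d_eq frag_cmul_distrib2 flip: power_mult_distrib)
      moreover have "Poly_Mapping.keys e \<subseteq> cliques V F (Suc n)"
        using join_clique[of a n] keys_a N_eq keys_cmul[of "(-1) ^ n" "join_vertex v a"]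
        by (auto simp: e_def)
      ultimately show ?thesis by blast
    next
      case False
      then have small: "card N < 2 * (n - 1)"
        using less.prems(3)[OF v(1)] by (simp add: N_def)
      then have k: "k > 0" using n by simp
      \<comment> \<open>Fill \<open>d\<close> inside the lower link, where the degree is one
        less.\<close>
      have "\<exists>e. Poly_Mapping.keys e \<subseteq> cliques N F (Suc k) \<and> augmented_boundary e = d"
      proof (rule less.hyps[OF card_N N(2) k])
        show "lower_nbrs N F u = {w \<in> N. w < u} \<or> card (lower_nbrs N F u) < 2 * (k - 1)" if u: "u \<in> N" for u
        proof (rule disjCI)
          assume "\<not> card (lower_nbrs N F u) < 2 * (k - 1)"
          \<comment> \<open>\<open>N\<close> has at most \<open>2 * k - 1\<close> vertices, hence
            \<open>N - {u}\<close> has at most \<open>2 * (k - 1)\<close>.\<close>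
          then have "card (lower_nbrs N F u) \<ge> card (N - {u})"
            using small n N u by (simp add: card_Diff_singleton)
          then have "lower_nbrs N F u = N - {u}"
            using N by (intro card_seteq) (auto simp: lower_nbrs_def)
          then show "lower_nbrs N F u = {w \<in> N. w < u}"
            by (auto simp: lower_nbrs_def)
        qed
      qed (use keys_d bd n in auto)
      then obtain e where e: "Poly_Mapping.keys e \<subseteq> cliques N F n" "augmented_boundary e = d"
        using n by auto
      \<comment> \<open>This is \<open>c\<close> minus the boundary of the join of \<open>v\<close>
        with \<open>e\<close>; the simplices through \<open>v\<close> have cancelled.\<close>
      define c' where "c' = a - frag_cmul ((-1) ^ n) e"
      have "\<exists>f. Poly_Mapping.keys f \<subseteq> cliques (V - {v}) F (Suc n) \<and> augmented_boundary f = c'"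
      proof (rule less.hyps[OF card_V'])
        show "lower_nbrs (V - {v}) F u = {w \<in> V - {v}. w < u} \<or> card (lower_nbrs (V - {v}) F u) < 2 * (n - 1)"
          if "u \<in> V - {v}" for u
        proof -
          \<comment> \<open>Deleting the largest vertex leaves the lower neighbourhoods of the
            others unchanged.\<close>
          have "v \<notin> lower_nbrs V F u" "v \<notin> {w \<in> V. w < u}" "lower_nbrs (V - {v}) F u = lower_nbrs V F u - {v}"
            using v(2)[of u] that by (auto simp: lower_nbrs_def)
          then show ?thesis
            using less.prems(3)[of u] that by auto
        qed
        show "Poly_Mapping.keys c' \<subseteq> cliques (V - {v}) F n"
          unfolding c'_def using keys_a e(1) N_V' keys_cmul by (intro keys_diffI) blast+
        show "augmented_boundary c' = 0"
          using bd(2) n e(2) by (simp add: c'_def add_eq_0_iff2 add.commute flip: minus_frag_cmul)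
      qed (use less.prems in auto)
      then obtain f where f: "Poly_Mapping.keys f \<subseteq> cliques (V - {v}) F (Suc n)" "augmented_boundary f = c'"
        by blast
      have "augmented_boundary (join_vertex v e + f) = c"
        using bd_join[of e n] e N_V'[of n] by (simp add: f c'_def c)
      moreover have "Poly_Mapping.keys (join_vertex v e + f) \<subseteq> cliques V F (Suc n)"
        using join_clique[OF e(1)] f(1) by (intro keys_addI) (auto simp: cliques_def)
      ultimately show ?thesis by blast
    qed
  qed
qed

section \<open>Betti numbers of simplicial complexes\<close>

definition simplicial_complex :: "'a set set \<Rightarrow> bool" where
  "simplicial_complex K \<longleftrightarrow> (\<forall>\<sigma>\<in>K. \<forall>\<tau>\<subseteq>\<sigma>. \<tau> \<noteq> {} \<longrightarrow> \<tau> \<in> K)"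

definition cycle_group :: "nat \<Rightarrow> 'a::linorder set set \<Rightarrow> ('a set \<Rightarrow>\<^sub>0 int) monoid" where
  "cycle_group q K = subgroup_generated (simplicial_chain_group q K) (simplicial_cycles q K)"

lemma carrier_simplicial_chain_group:
  "c \<in> carrier (simplicial_chain_group q K)
    \<longleftrightarrow> Poly_Mapping.keys c \<subseteq> {\<sigma> \<in> K. finite \<sigma> \<and> card \<sigma> = Suc q}"
  by (simp add: simplicial_chain_group_def)

lemma simplicial_boundary_simps [simp]:
  "simplicial_boundary q 0 = 0"
  "simplicial_boundary q (a - b) = simplicial_boundary q a - simplicial_boundary q b"
  "simplicial_boundary q (a + b) = simplicial_boundary q a + simplicial_boundary q b"
  "simplicial_boundary q (- a) = - simplicial_boundary q a"
  "simplicial_boundary q (frag_cmul k a) = frag_cmul k (simplicial_boundary q a)"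
  by (simp_all add: simplicial_boundary_def frag_linear)

text \<open>The two boundaries part only in degree 0, where the unreduced one is zero and the
  augmented one sums the coefficients of the vertices.\<close>

lemma simplicial_boundary_eq:
  assumes "q > 0" "\<And>\<sigma>. \<sigma> \<in> Poly_Mapping.keys c \<Longrightarrow> card \<sigma> = Suc q"
  shows "simplicial_boundary q c = augmented_boundary c"
  unfolding simplicial_boundary_def augmented_boundary_def
  using assms by (auto simp: faces_def lessThan_Suc_atMost intro!: frag_extend_eq)

lemma subgroup_free_Abelian_groupI:
  assumes "\<And>x. x \<in> H \<Longrightarrow> Poly_Mapping.keys x \<subseteq> S" "0 \<in> H"
    "\<And>x y. x \<in> H \<Longrightarrow> y \<in> H \<Longrightarrow> x + y \<in> H" "\<And>x. x \<in> H \<Longrightarrow> - x \<in> H"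
  shows "subgroup H (free_Abelian_group S)"
  using assms by (intro group.subgroupI[OF group_free_Abelian_group]) auto

lemma subgroup_simplicial_cycles: "subgroup (simplicial_cycles q K) (simplicial_chain_group q K)"
  unfolding simplicial_chain_group_def
  by (rule subgroup_free_Abelian_groupI)
     (auto simp: simplicial_cycles_def simplicial_chain_group_def dest!: subsetD[OF keys_add])

lemma subgroup_simplicial_boundaries:
  assumes "simplicial_complex K"
  shows "subgroup (simplicial_boundaries q K) (cycle_group q K)"
proof -
  have cyc: "simplicial_boundary (Suc q) c \<in> simplicial_cycles q K"
    if "c \<in> carrier (simplicial_chain_group (Suc q) K)" for c
  proof -
    have c: "\<sigma> \<in> K \<and> finite \<sigma> \<and> card \<sigma> = Suc (Suc q)" if "\<sigma> \<in> Poly_Mapping.keys c" for \<sigma>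
      using \<open>c \<in> _\<close> that unfolding carrier_simplicial_chain_group by blast
    have bd: "simplicial_boundary (Suc q) c = augmented_boundary c"
      using c by (intro simplicial_boundary_eq) auto
    have keys: "\<tau> \<in> K \<and> finite \<tau> \<and> card \<tau> = Suc q" if "\<tau> \<in> Poly_Mapping.keys (augmented_boundary c)" for \<tau>
    proof -
      obtain \<sigma> v where \<sigma>: "\<sigma> \<in> Poly_Mapping.keys c" "v \<in> \<sigma>" "\<tau> = \<sigma> - {v}"
        using \<open>\<tau> \<in> _\<close> keys_augmented_boundary[of c] by blast
      then have "card \<tau> = Suc q" using c[OF \<sigma>(1)] by (simp add: card_Diff_singleton)
      moreover from this have "\<tau> \<noteq> {}" by auto
      ultimately show ?thesis
        using assms c[OF \<sigma>(1)] \<sigma>(3) unfolding simplicial_complex_def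
        by (metis Diff_subset finite_Diff)
    qed
    have "simplicial_boundary q (augmented_boundary c) = 0"
    proof (cases "q = 0")
      case False
      then have "simplicial_boundary q (augmented_boundary c) = augmented_boundary (augmented_boundary c)"
        using keys by (intro simplicial_boundary_eq) auto
      then show ?thesis using augmented_boundary_boundary c by metis
    qed (simp add: simplicial_boundary_def)
    then show ?thesis
      using keys by (auto simp: simplicial_cycles_def carrier_simplicial_chain_group bd)
  qed
  have "subgroup (simplicial_boundaries q K) (simplicial_chain_group q K)"
    unfolding simplicial_chain_group_def
  proof (rule subgroup_free_Abelian_groupI)
    show "Poly_Mapping.keys x \<subseteq> {\<sigma> \<in> K. finite \<sigma> \<and> card \<sigma> = Suc q}"
      if x: "x \<in> simplicial_boundaries q K" for x
    proof -
      obtain c where "c \<in> carrier (simplicial_chain_group (Suc q) K)" "x = simplicial_boundary (Suc q) c"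
        using x unfolding simplicial_boundaries_def by auto
      then show ?thesis
        using cyc[of c] by (simp add: simplicial_cycles_def carrier_simplicial_chain_group)
    qed
    show "0 \<in> simplicial_boundaries q K"
      unfolding simplicial_boundaries_def
      by (rule image_eqI[of _ _ 0]) (auto simp: carrier_simplicial_chain_group)
    show "x + y \<in> simplicial_boundaries q K"
      if xy: "x \<in> simplicial_boundaries q K" "y \<in> simplicial_boundaries q K" for x y
    proof -
      obtain c d where "c \<in> carrier (simplicial_chain_group (Suc q) K)" "x = simplicial_boundary (Suc q) c"
        "d \<in> carrier (simplicial_chain_group (Suc q) K)" "y = simplicial_boundary (Suc q) d"
        using xy unfolding simplicial_boundaries_def by blast
      then show ?thesis
        unfolding simplicial_boundaries_def carrier_simplicial_chain_group
        by (intro image_eqI[of _ _ "c + d"]) (simp_all add: carrier_simplicial_chain_group keys_addI)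
    qed
    show "- x \<in> simplicial_boundaries q K" if x: "x \<in> simplicial_boundaries q K" for x
    proof -
      obtain c where "c \<in> carrier (simplicial_chain_group (Suc q) K)" "x = simplicial_boundary (Suc q) c"
        using x unfolding simplicial_boundaries_def by blast
      then show ?thesis
        unfolding simplicial_boundaries_def
        by (intro image_eqI[of _ _ "- c"]) (simp_all add: carrier_simplicial_chain_group)
    qed
  qed
  moreover have "simplicial_boundaries q K \<subseteq> simplicial_cycles q K"
    using cyc by (auto simp: simplicial_boundaries_def)
  ultimately show ?thesis
    unfolding cycle_group_def
    by (simp add: group.subgroup_of_subgroup_generated simplicial_chain_group_def)
qed

lemma carrier_cycle_group [simp]: "carrier (cycle_group q K) = simplicial_cycles q K"
  unfolding cycle_group_def by (rule subgroup.carrier_subgroup_generated_subgroup[OF subgroup_simplicial_cycles])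

lemma comm_group_cycle_group: "comm_group (cycle_group q K)"
  unfolding cycle_group_def simplicial_chain_group_def
  by (rule group.abelian_subgroup_generated[OF group_free_Abelian_group abelian_free_Abelian_group])

lemma cycle_group_simps [simp]:
  "\<one>\<^bsub>cycle_group q K\<^esub> = 0" "x \<otimes>\<^bsub>cycle_group q K\<^esub> y = x + y"
  by (simp_all add: cycle_group_def simplicial_chain_group_def)

text \<open>Passes from multiplicative group notation to sums of chains.\<close>

lemma finprod_cycle_group:
  assumes "finite I" "z ` I \<subseteq> simplicial_cycles q K"
  shows "finprod (cycle_group q K) (\<lambda>i. z i [^]\<^bsub>cycle_group q K\<^esub> (c i :: int)) I
       = (\<Sum>i\<in>I. frag_cmul (c i) (z i))"
proof -
  interpret comm_group "cycle_group q K" by (rule comm_group_cycle_group)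
  show ?thesis
    using assms
  proof (induction I rule: finite_induct)
    case empty
    then show ?case by simp
  next
    case (insert i I)
    have "Poly_Mapping.keys (z i) \<subseteq> {\<sigma> \<in> K. finite \<sigma> \<and> card \<sigma> = Suc q}"
      "z i \<in> carrier (subgroup_generated (simplicial_chain_group q K) (simplicial_cycles q K))"
      using insert.prems carrier_cycle_group[of q K]
      by (auto simp: simplicial_cycles_def carrier_simplicial_chain_group cycle_group_def)
    then have "z i [^]\<^bsub>cycle_group q K\<^esub> c i = frag_cmul (c i) (z i)"
      unfolding cycle_group_def simplicial_chain_group_def
      by (subst group.int_pow_subgroup_generated) auto
    moreover have "(\<lambda>i. z i [^]\<^bsub>cycle_group q K\<^esub> c i) \<in> I \<rightarrow> carrier (cycle_group q K)"
      "z i [^]\<^bsub>cycle_group q K\<^esub> c i \<in> carrier (cycle_group q K)"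
      using insert.prems by (auto intro!: int_pow_closed simp del: carrier_cycle_group simp: carrier_cycle_group[symmetric])
    ultimately show ?case
      using insert by (subst finprod_insert) auto
  qed
qed

definition homologically_independent ::
    "nat \<Rightarrow> 'a::linorder set set \<Rightarrow> 'i set \<Rightarrow> ('i \<Rightarrow> 'a set \<Rightarrow>\<^sub>0 int) \<Rightarrow> bool" where
  "homologically_independent q K I z \<longleftrightarrow>
     finite I \<and> z ` I \<subseteq> simplicial_cycles q K \<and>
     (\<forall>c. (\<Sum>i\<in>I. frag_cmul (c i) (z i)) \<in> simplicial_boundaries q K \<longrightarrow> (\<forall>i\<in>I. c i = 0))"

lemma independent_modulo_boundaries:
  "independent_modulo (cycle_group q K) (simplicial_boundaries q K) I z
    \<longleftrightarrow> homologically_independent q K I z"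
  using finprod_cycle_group[of I z q K]
  by (auto simp: independent_modulo_def homologically_independent_def)

lemma betti_le:
  fixes K :: "'a::linorder set set"
  assumes "simplicial_complex K"
    and "\<And>(S :: ('a set \<Rightarrow>\<^sub>0 int) set set) r. homologically_independent q K S r \<Longrightarrow> card S \<le> n"
  shows "betti q K \<le> n"
  unfolding betti_def simplicial_homology_group_def cycle_group_def[symmetric]
  by (rule comm_group.abelian_rank_Mod_le[OF comm_group_cycle_group subgroup_simplicial_boundaries[OF assms(1)]])
     (auto simp: independent_modulo_boundaries intro: assms(2))

lemma betti_ge:
  fixes K :: "'a::linorder set set"
  assumes "simplicial_complex K"
    and "\<And>(S :: ('a set \<Rightarrow>\<^sub>0 int) set set) r. homologically_independent q K S r \<Longrightarrow> card S \<le> n"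
    and "homologically_independent q K I z"
  shows "card I \<le> betti q K"
  unfolding betti_def simplicial_homology_group_def cycle_group_def[symmetric]
  by (rule comm_group.abelian_rank_Mod_ge[OF comm_group_cycle_group subgroup_simplicial_boundaries[OF assms(1)], where n = n])
     (auto simp: independent_modulo_boundaries intro: assms(2,3))

section \<open>Clique complexes of graphs with a spanning tree\<close>

text \<open>Fewer equations than unknowns: Gaussian elimination over the integers, cross-multiplying
  by the pivot to avoid division.\<close>

lemma integer_relation:
  fixes f :: "'s \<Rightarrow> 'j \<Rightarrow> int"
  assumes "finite J" "finite S" "card J < card S"
  shows "\<exists>c. (\<exists>s\<in>S. c s \<noteq> 0) \<and> (\<forall>j\<in>J. (\<Sum>s\<in>S. c s * f s j) = 0)"
  using assms
proof (induction J arbitrary: S f rule: finite_induct)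
  case empty
  then have "S \<noteq> {}" by auto
  then show ?case by (intro exI[of _ "\<lambda>_. 1"]) auto
next
  case (insert j J)
  show ?case
  proof (cases "\<forall>s\<in>S. f s j = 0")
    case True
    obtain c where "\<exists>s\<in>S. c s \<noteq> 0" "\<forall>i\<in>J. (\<Sum>s\<in>S. c s * f s i) = 0"
      using insert.IH[OF insert.prems(1), of f] insert.prems insert.hyps by auto
    then show ?thesis
      using True by (intro exI[of _ c]) auto
  next
    case False
    then obtain t where t: "t \<in> S" "f t j \<noteq> 0" by blast
    \<comment> \<open>Eliminates the unknown at \<open>t\<close>: \<open>f t j\<close> times
      equation \<open>i\<close>, minus \<open>f t i\<close> times equation \<open>j\<close>.\<close>
    define g where "g s i = f t j * f s i - f s j * f t i" for s i
    obtain c where c: "\<exists>s\<in>S - {t}. c s \<noteq> 0" "\<forall>i\<in>J. (\<Sum>s\<in>S - {t}. c s * g s i) = 0"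
      using insert.IH[of "S - {t}" g] insert.prems insert.hyps t
      by (auto simp: card_Diff_singleton less_diff_conv)
    \<comment> \<open>Scaling by the pivot makes the value at \<open>t\<close> forced by equation
      \<open>j\<close> an integer.\<close>
    define d where "d s = (if s = t then - (\<Sum>s\<in>S - {t}. c s * f s j) else c s * f t j)" for s
    have "(\<Sum>s\<in>S. d s * f s i) = (\<Sum>s\<in>S - {t}. c s * g s i)" for i
    proof -
      have "(\<Sum>s\<in>S. d s * f s i) = d t * f t i + (\<Sum>s\<in>S - {t}. d s * f s i)"
        using insert.prems t by (simp add: sum.remove)
      also have "(\<Sum>s\<in>S - {t}. d s * f s i) = (\<Sum>s\<in>S - {t}. c s * f t j * f s i)"
        by (intro sum.cong) (auto simp: d_def)
      also have "d t * f t i = - (\<Sum>s\<in>S - {t}. c s * f s j * f t i)"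
        by (simp add: d_def sum_distrib_right)
      finally show ?thesis
        by (simp add: g_def algebra_simps sum_subtractf)
    qed
    moreover have "(\<Sum>s\<in>S - {t}. c s * g s j) = 0"
      by (simp add: g_def)
    moreover have "\<exists>s\<in>S. d s \<noteq> 0"
      using c(1) t by (auto simp: d_def)
    ultimately show ?thesis
      using c(2) by (intro exI[of _ d]) auto
  qed
qed

lemma simplicial_cycles_sum:
  assumes "\<And>i. i \<in> I \<Longrightarrow> z i \<in> simplicial_cycles q K"
  shows "(\<Sum>i\<in>I. frag_cmul (c i) (z i)) \<in> simplicial_cycles q K"
  using assms
proof (induction I rule: infinite_finite_induct)
  case (insert i I)
  then have "Poly_Mapping.keys (z i) \<subseteq> {\<sigma> \<in> K. finite \<sigma> \<and> card \<sigma> = Suc q}"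
    by (auto simp: simplicial_cycles_def carrier_simplicial_chain_group)
  then have "Poly_Mapping.keys (frag_cmul (c i) (z i)) \<subseteq> {\<sigma> \<in> K. finite \<sigma> \<and> card \<sigma> = Suc q}"
    using keys_cmul by (rule order.trans[rotated])
  with insert show ?case
    by (simp add: simplicial_cycles_def carrier_simplicial_chain_group keys_addI)
qed (auto simp: simplicial_cycles_def carrier_simplicial_chain_group)

context
  fixes K :: "'a::linorder set set" and J :: "'j set" and \<phi> :: "'j \<Rightarrow> ('a set \<Rightarrow>\<^sub>0 int) \<Rightarrow> int" and q :: nat
  assumes K: "simplicial_complex K" and J: "finite J"
    and add: "\<And>j a b. \<phi> j (a + b) = \<phi> j a + \<phi> j b"
    and cmul: "\<And>j k a. \<phi> j (frag_cmul k a) = k * \<phi> j a"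
    and detect: "\<And>z. z \<in> simplicial_cycles q K \<Longrightarrow> (\<And>j. j \<in> J \<Longrightarrow> \<phi> j z = 0) \<Longrightarrow> z \<in> simplicial_boundaries q K"
begin

text \<open>More cycles than functionals admit an integer relation that all functionals kill; the
  combination is then a boundary although its coefficients do not all vanish.\<close>

lemma card_le_of_detecting_functionals:
  assumes "homologically_independent q K S r"
  shows "card S \<le> card J"
proof (rule ccontr)
  assume "\<not> card S \<le> card J"
  moreover have S: "finite S" "\<And>s. s \<in> S \<Longrightarrow> r s \<in> simplicial_cycles q K"
    using assms by (auto simp: homologically_independent_def)
  ultimately obtain c where c: "\<exists>s\<in>S. c s \<noteq> 0" "\<forall>j\<in>J. (\<Sum>s\<in>S. c s * \<phi> j (r s)) = 0"
    using integer_relation[OF J, of S "\<lambda>s j. \<phi> j (r s)"] by auto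
  have "\<phi> j 0 = 0" for j
    using cmul[of j 0 0] by simp
  then have "\<phi> j (\<Sum>s\<in>S. frag_cmul (c s) (r s)) = (\<Sum>s\<in>S. c s * \<phi> j (r s))" for j
    by (induction S rule: infinite_finite_induct) (auto simp: add cmul)
  then have "(\<Sum>s\<in>S. frag_cmul (c s) (r s)) \<in> simplicial_boundaries q K"
    using c S by (intro detect simplicial_cycles_sum) auto
  then show False
    using assms c(1) unfolding homologically_independent_def by blast
qed

lemma betti_le_card: "betti q K \<le> card J"
  by (rule betti_le[OF K card_le_of_detecting_functionals])

text \<open>The detecting functionals supply the upper bound that a lower estimate of the rank
  presupposes.\<close>

lemma card_le_betti: "homologically_independent q K I z \<Longrightarrow> card I \<le> betti q K"
  by (rule betti_ge[OF K card_le_of_detecting_functionals])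

end

section \<open>Homology of clique complexes by augmented chains\<close>

lemma simplicial_complex_clique_complex: "simplicial_complex (clique_complex V F)"
  unfolding simplicial_complex_def clique_complex_def
  by (auto intro: finite_subset)

lemma clique_complex_simplices:
  "{\<sigma> \<in> clique_complex V F. finite \<sigma> \<and> card \<sigma> = Suc q} = cliques V F (Suc q)"
  unfolding clique_complex_def cliques_def by auto

lemma simplicial_cycles_clique_complex:
  assumes "q > 0"
  shows "z \<in> simplicial_cycles q (clique_complex V F)
    \<longleftrightarrow> Poly_Mapping.keys z \<subseteq> cliques V F (Suc q) \<and> augmented_boundary z = 0"
  using assms simplicial_boundary_eq[of q z]
  unfolding simplicial_cycles_def carrier_simplicial_chain_group clique_complex_simplices mem_Collect_eq
  by (auto simp: cliques_def subset_iff)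

lemma simplicial_boundaries_clique_complex:
  "z \<in> simplicial_boundaries q (clique_complex V F)
    \<longleftrightarrow> (\<exists>x. Poly_Mapping.keys x \<subseteq> cliques V F (Suc (Suc q)) \<and> augmented_boundary x = z)"
proof -
  have "simplicial_boundary (Suc q) x = augmented_boundary x"
    if "Poly_Mapping.keys x \<subseteq> cliques V F (Suc (Suc q))" for x
    using that by (intro simplicial_boundary_eq) (auto simp: cliques_def)
  then show ?thesis
    unfolding simplicial_boundaries_def image_iff Bex_def carrier_simplicial_chain_group clique_complex_simplices
    by metis
qed

text \<open>Degree \<open>q\<close> means \<open>q + 1\<close> vertices, so
  \<open>flag_cycle_bounds\<close> applies with \<open>Suc q\<close> and every cycle bounds.\<close>

lemma betti_clique_complex_eq_0:
  assumes "finite V" "q > 0" "\<And>v. v \<in> V \<Longrightarrow> card (lower_nbrs V F v) < 2 * q"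
  shows "betti q (clique_complex V F) = 0"
proof -
  have "z \<in> simplicial_boundaries q (clique_complex V F)"
    if "z \<in> simplicial_cycles q (clique_complex V F)" for z
    using that flag_cycle_bounds[of V "Suc q" F z] assms
    by (auto simp: simplicial_boundaries_clique_complex simplicial_cycles_clique_complex)
  \<comment> \<open>As all cycles bound, the empty family of functionals detects boundaries.\<close>
  then have "betti q (clique_complex V F) \<le> card ({} :: nat set)"
    by (intro betti_le_card[of _ _ "\<lambda>_ _. 0"] simplicial_complex_clique_complex) auto
  then show ?thesis by simp
qed

section \<open>Betti numbers in degrees 0 and 1 from a spanning tree\<close>

lemma augmented_boundary_edge:
  assumes "u < v"
  shows "augmented_boundary (frag_of {u, v}) = frag_of {v} - frag_of {u}"
proof -
  have "sorted_list_of_set {u, v} = [u, v]"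
    using assms by auto
  moreover have "{u, v} - {u} = {v}" "{u, v} - {v} = {u}"
    using assms by auto
  ultimately show ?thesis
    using assms by (simp add: faces_def eval_nat_numeral)
qed

lemma augmented_boundary_vertex: "augmented_boundary (frag_of {v}) = frag_of {}"
  by (simp add: faces_def)

text \<open>Every vertex except the root 1 selects an edge to a smaller vertex; labels decrease
  along the selected edges, so these form a spanning tree.\<close>

locale rooted_graph =
  fixes T :: nat and F :: "nat set set" and parent :: "nat \<Rightarrow> nat"
  assumes T: "T \<ge> 1"
    and parent: "\<And>t. 2 \<le> t \<Longrightarrow> t \<le> T \<Longrightarrow> 1 \<le> parent t \<and> parent t < t \<and> {parent t, t} \<in> F"
begin

abbreviation "complex \<equiv> clique_complex {1..T} F"
abbreviation "edges \<equiv> cliques {1..T} F 2"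
abbreviation "triangles \<equiv> cliques {1..T} F 3"
definition "tree = (\<lambda>t. {parent t, t}) ` {2..T}"

lemma edgeE:
  assumes "e \<in> edges"
  obtains u v where "u < v" "u \<in> {1..T}" "v \<in> {1..T}" "e = {u, v}"
proof -
  obtain u v where "u \<noteq> v" "e = {u, v}" "u \<in> {1..T}" "v \<in> {1..T}"
    using assms by (auto simp: cliques_def card_2_iff)
  then show ?thesis
    using that[of u v] that[of v u] by (auto simp: insert_commute neq_iff)
qed

lemma finite_cliques: "finite (cliques {1..T} F n)"
  by (rule finite_subset[of _ "Pow {1..T}"]) (auto simp: cliques_def)

lemma tree_subset: "tree \<subseteq> edges"
proof
  fix e assume "e \<in> tree"
  then obtain t where "t \<in> {2..T}" "e = {parent t, t}"
    by (auto simp: tree_def)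
  then show "e \<in> edges"
    using parent[of t] by (auto simp: cliques_def insert_commute)
qed

lemma card_tree: "card tree = T - 1"
proof -
  have "inj_on (\<lambda>t. {parent t, t}) {2..T}"
  proof (rule inj_onI)
    fix s t assume "s \<in> {2..T}" "t \<in> {2..T}" "{parent s, s} = {parent t, t}"
    then show "s = t"
      using parent[of s] parent[of t] by (auto simp: doubleton_eq_iff)
  qed
  then show ?thesis by (simp add: tree_def card_image)
qed

text \<open>Follow parents down to the root; the boundaries of the traversed edges
  telescope.\<close>

lemma tree_path:
  assumes "v \<in> {1..T}"
  shows "\<exists>p. Poly_Mapping.keys p \<subseteq> tree \<and> augmented_boundary p = frag_of {v} - frag_of {1}"
  using assms
proof (induction v rule: less_induct)
  case (less v)
  show ?case
  proof (cases "v = 1")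
    case True
    then show ?thesis by (intro exI[of _ 0]) auto
  next
    case False
    then have v: "1 \<le> parent v" "parent v < v" "v \<in> {2..T}"
      using less.prems parent[of v] by auto
    then obtain p where p: "Poly_Mapping.keys p \<subseteq> tree" "augmented_boundary p = frag_of {parent v} - frag_of {1}"
      using less.IH[of "parent v"] less.prems by auto
    have "Poly_Mapping.keys (p + frag_of {parent v, v}) \<subseteq> tree"
      using p v by (intro keys_addI) (auto simp: tree_def)
    moreover have "augmented_boundary (p + frag_of {parent v, v}) = frag_of {v} - frag_of {1}"
      unfolding augmented_boundary_simps(3) p augmented_boundary_edge[OF v(2)] by simp
    ultimately show ?thesis by blast
  qed
qed

text \<open>Take the largest \<open>t\<close> whose edge to its parent occurs in \<open>z\<close>.
  The boundary at \<open>t\<close> is the coefficient of that edge alone, so it cannot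
  vanish.\<close>

lemma tree_cycle_eq_0:
  assumes "Poly_Mapping.keys z \<subseteq> tree" "augmented_boundary z = 0"
  shows "z = 0"
proof (rule ccontr)
  assume "z \<noteq> 0"
  define A where "A = {t \<in> {2..T}. {parent t, t} \<in> Poly_Mapping.keys z}"
  obtain e where "e \<in> Poly_Mapping.keys z"
    using \<open>z \<noteq> 0\<close> by (metis ex_in_conv keys_eq_empty)
  moreover from this obtain t where "t \<in> {2..T}" "e = {parent t, t}"
    using assms(1) by (auto simp: tree_def)
  ultimately have "A \<noteq> {}" "finite A"
    by (auto simp: A_def)
  define t where "t = Max A"
  have t: "t \<in> A" "\<And>s. s \<in> A \<Longrightarrow> s \<le> t"
    using \<open>A \<noteq> {}\<close> \<open>finite A\<close> by (auto simp: t_def)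
  \<comment> \<open>By maximality only the edge from \<open>t\<close> to its parent meets
    \<open>t\<close>, and the larger endpoint of an edge has sign +1.\<close>
  have faces: "poly_mapping.lookup (faces e) {t} = (if e = {parent t, t} then 1 else 0)"
    if e: "e \<in> Poly_Mapping.keys z" for e
  proof -
    have "e \<in> tree" using e assms(1) by blast
    then obtain s where "s \<in> {2..T}" and s': "e = {parent s, s}"
      by (auto simp: tree_def)
    then have s: "s \<in> A" "e = {parent s, s}"
      using e by (simp_all add: A_def)
    have s': "parent s < s" "s \<le> t" "parent t < t"
      using s(1) t parent by (auto simp: A_def)
    then show ?thesis
      using augmented_boundary_edge[OF s'(1)] s(2) by (auto simp: lookup_minus doubleton_eq_iff)
  qed
  have "0 = poly_mapping.lookup (augmented_boundary z) {t}"
    using assms(2) by simp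
  also have "\<dots> = (\<Sum>e\<in>Poly_Mapping.keys z. poly_mapping.lookup z e * poly_mapping.lookup (faces e) {t})"
    by (simp add: augmented_boundary_def frag_extend_def lookup_sum)
  also have "\<dots> = (\<Sum>e\<in>Poly_Mapping.keys z. if e = {parent t, t} then poly_mapping.lookup z e else 0)"
    by (intro sum.cong) (auto simp: faces)
  also have "\<dots> = poly_mapping.lookup z {parent t, t}"
    using t(1) by (simp add: A_def)
  finally show False
    using t(1) by (simp add: A_def in_keys_iff)
qed

text \<open>The coefficient of the empty simplex is the sum of the coefficients of \<open>c\<close>;
  modulo boundaries of tree edges every vertex equals the root.\<close>

lemma vertex_chain_homologous:
  assumes "Poly_Mapping.keys c \<subseteq> cliques {1..T} F 1"
  shows "\<exists>p. Poly_Mapping.keys p \<subseteq> tree \<and>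
    augmented_boundary p = c - frag_cmul (poly_mapping.lookup (augmented_boundary c) {}) (frag_of {1})"
  using assms
proof (induction c rule: frag_induction)
  case zero
  then show ?case by (intro exI[of _ 0]) auto
next
  case (one \<sigma>)
  then obtain v where v: "\<sigma> = {v}" "v \<in> {1..T}"
    by (auto simp: cliques_def card_1_singleton_iff)
  then show ?case
    using tree_path[of v] augmented_boundary_vertex[of v] by simp
next
  case (diff a b)
  then obtain p r where
    "Poly_Mapping.keys p \<subseteq> tree" "augmented_boundary p = a - frag_cmul (poly_mapping.lookup (augmented_boundary a) {}) (frag_of {1})"
    "Poly_Mapping.keys r \<subseteq> tree" "augmented_boundary r = b - frag_cmul (poly_mapping.lookup (augmented_boundary b) {}) (frag_of {1})"
    by blast
  then show ?case
    by (intro exI[of _ "p - r"]) (auto simp: lookup_minus frag_cmul_diff_distrib dest!: subsetD[OF keys_diff])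
qed

text \<open>The coefficient sum alone detects boundaries, which gives rank at most 1; it vanishes on
  boundaries but not on the root, which gives rank at least 1.\<close>

lemma betti_0: "betti 0 complex = 1"
proof (rule antisym)
  let ?\<phi> = "\<lambda>(_::nat) c. poly_mapping.lookup (augmented_boundary c) {}"
  have add: "?\<phi> j (a + b) = ?\<phi> j a + ?\<phi> j b" "?\<phi> j (frag_cmul k a) = k * ?\<phi> j a" for j a b k
    by (simp_all add: lookup_add)
  have detect: "z \<in> simplicial_boundaries 0 complex"
    if "z \<in> simplicial_cycles 0 complex" "\<And>j. j \<in> {0} \<Longrightarrow> ?\<phi> j z = 0" for z
  proof -
    have "Poly_Mapping.keys z \<subseteq> cliques {1..T} F 1"
      using that(1) by (simp add: simplicial_cycles_def carrier_simplicial_chain_group clique_complex_simplices)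
    then show ?thesis
      using vertex_chain_homologous[of z] that(2) tree_subset
      by (auto simp: simplicial_boundaries_clique_complex numeral_2_eq_2)
  qed
  have "betti 0 complex \<le> card {0::nat}"
    by (rule betti_le_card[where \<phi> = ?\<phi>, OF simplicial_complex_clique_complex])
       (simp, rule add(1), rule add(2), rule detect, assumption, assumption)
  then show "betti 0 complex \<le> 1" by simp
  have "c 0 = 0" if "(\<Sum>i\<in>{0::nat}. frag_cmul (c i) (frag_of {1})) \<in> simplicial_boundaries 0 complex" for c
  proof -
    from that obtain x where x: "Poly_Mapping.keys x \<subseteq> cliques {1..T} F 2"
      "augmented_boundary x = frag_cmul (c 0) (frag_of {1})"
      unfolding simplicial_boundaries_clique_complex by (auto simp: numeral_2_eq_2)
    have "frag_cmul (c 0) (frag_of {}) = augmented_boundary (augmented_boundary x)"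
      using x(2) augmented_boundary_vertex[of "1::nat"] by (simp del: One_nat_def)
    also have "\<dots> = 0"
      using x(1) by (intro augmented_boundary_boundary) (auto simp: cliques_def)
    finally show ?thesis by simp
  qed
  then have "homologically_independent 0 complex {0::nat} (\<lambda>_. frag_of {1})"
    using T by (auto simp: homologically_independent_def simplicial_cycles_def simplicial_boundary_def
        carrier_simplicial_chain_group clique_complex_def)
  then have "card {0::nat} \<le> betti 0 complex"
    by (rule card_le_betti[where \<phi> = ?\<phi> and J = "{0}", OF simplicial_complex_clique_complex, rotated 4])
       (simp, rule add(1), rule add(2), rule detect, assumption, assumption)
  then show "1 \<le> betti 0 complex" by simp
qed

text \<open>Such a cycle is supported on the tree and hence zero.\<close>

lemma non_tree_coefficients_detect:
  assumes "z \<in> simplicial_cycles 1 complex"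
    and "\<And>e. e \<in> edges - tree \<Longrightarrow> poly_mapping.lookup z e = 0"
  shows "z \<in> simplicial_boundaries 1 complex"
proof -
  have z: "Poly_Mapping.keys z \<subseteq> edges" "augmented_boundary z = 0"
    using assms(1) by (simp_all add: simplicial_cycles_clique_complex numeral_2_eq_2)
  then have "Poly_Mapping.keys z \<subseteq> tree"
    using assms(2) by (auto simp: in_keys_iff)
  then have "z = 0"
    using z tree_cycle_eq_0 by blast
  then show ?thesis
    unfolding simplicial_boundaries_clique_complex by (intro exI[of _ 0]) auto
qed

text \<open>The coefficients on the edges outside the tree are the detecting functionals. The
  additive form avoids truncated subtraction.\<close>

lemma betti_1_le: "betti 1 complex + (T - 1) \<le> card edges"
proof -
  have "betti 1 complex \<le> card (edges - tree)"
    by (rule betti_le_card[where \<phi> = "\<lambda>e z. poly_mapping.lookup z e", OF simplicial_complex_clique_complex])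
       (rule finite_Diff[OF finite_cliques], simp add: lookup_add, simp,
        rule non_tree_coefficients_detect, assumption, assumption)
  moreover have "card (edges - tree) = card edges - card tree" "card tree \<le> card edges"
    using tree_subset finite_cliques by (auto simp: card_Diff_subset finite_subset card_mono)
  ultimately show ?thesis by (simp add: card_tree)
qed

text \<open>Fundamental cycles of the edges in \<open>good\<close> are independent modulo
  boundaries. Every other edge is one of the \<open>T - 1\<close> tree edges or lies in a triangle,
  which has three edges.\<close>

lemma betti_1_ge: "card edges \<le> betti 1 complex + (T - 1) + 3 * card triangles"
proof -
  define good where "good = {e \<in> edges - tree. \<forall>\<tau>\<in>triangles. \<not> e \<subseteq> \<tau>}"
  \<comment> \<open>The fundamental cycle of \<open>e\<close>, closed up by the tree paths from its
    ends to the root.\<close>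
  have "\<exists>z. Poly_Mapping.keys (z - frag_of e) \<subseteq> tree \<and> augmented_boundary z = 0" if edge: "e \<in> edges" for e
  proof -
    obtain u v where e: "u < v" "u \<in> {1..T}" "v \<in> {1..T}" "e = {u, v}"
      using edgeE[OF edge] .
    obtain p where p: "Poly_Mapping.keys p \<subseteq> tree" "augmented_boundary p = frag_of {u} - frag_of {1}"
      using tree_path[OF e(2)] by blast
    obtain r where r: "Poly_Mapping.keys r \<subseteq> tree" "augmented_boundary r = frag_of {v} - frag_of {1}"
      using tree_path[OF e(3)] by blast
    have "augmented_boundary (frag_of e + (p - r)) = 0"
      unfolding augmented_boundary_simps(2,3) p r e(4) augmented_boundary_edge[OF e(1)] by simp
    moreover have "Poly_Mapping.keys (p - r) \<subseteq> tree"
      using p r by (intro keys_diffI)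
    ultimately show ?thesis
      by (intro exI[of _ "frag_of e + (p - r)"]) auto
  qed
  then obtain z where z: "\<And>e. e \<in> edges \<Longrightarrow> Poly_Mapping.keys (z e - frag_of e) \<subseteq> tree"
    "\<And>e. e \<in> edges \<Longrightarrow> augmented_boundary (z e) = 0"
    by metis
  have lookup_z: "poly_mapping.lookup (z e) f = (if f = e then 1 else 0)" if "e \<in> edges" "f \<notin> tree" for e f
  proof -
    have "poly_mapping.lookup (z e - frag_of e) f = 0"
      using z(1)[OF that(1)] that(2) by (meson in_keys_iff subsetD)
    then show ?thesis by (simp add: lookup_minus split: if_splits)
  qed
  have "homologically_independent 1 complex good z"
    unfolding homologically_independent_def
  proof (intro conjI allI impI ballI)
    show "finite good"
      using finite_cliques by (auto simp: good_def)
    show "z ` good \<subseteq> simplicial_cycles 1 complex"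
    proof
      fix y assume "y \<in> z ` good"
      then obtain e where e: "e \<in> edges" "y = z e" by (auto simp: good_def)
      have "Poly_Mapping.keys ((z e - frag_of e) + frag_of e) \<subseteq> edges"
        using z(1)[OF e(1)] tree_subset e(1) by (intro keys_addI) auto
      then show "y \<in> simplicial_cycles 1 complex"
        using z(2)[OF e(1)] e(2) by (simp add: simplicial_cycles_clique_complex numeral_2_eq_2)
    qed
    fix c e
    assume "(\<Sum>e\<in>good. frag_cmul (c e) (z e)) \<in> simplicial_boundaries 1 complex" and e: "e \<in> good"
    then obtain x where x: "Poly_Mapping.keys x \<subseteq> triangles" "augmented_boundary x = (\<Sum>e\<in>good. frag_cmul (c e) (z e))"
      unfolding simplicial_boundaries_clique_complex by (auto simp: numeral_3_eq_3)
    have "(\<Sum>f\<in>good. c f * poly_mapping.lookup (z f) e) = (\<Sum>f\<in>good. if f = e then c f else 0)"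
      using e lookup_z by (intro sum.cong) (auto simp: good_def)
    also have "\<dots> = c e"
      using e \<open>finite good\<close> by simp
    finally have "c e = poly_mapping.lookup (augmented_boundary x) e"
      unfolding x(2) by (simp add: lookup_sum)
    \<comment> \<open>The boundary of a chain of triangles involves only edges of triangles, and
      \<open>e\<close> lies in none.\<close>
    moreover have "e \<notin> Poly_Mapping.keys (augmented_boundary x)"
      using keys_augmented_boundary[of x] x(1) e by (auto simp: good_def)
    ultimately show "c e = 0" by (simp add: in_keys_iff)
  qed
  then have "card good \<le> betti 1 complex"
    by (rule card_le_betti[where \<phi> = "\<lambda>e z. poly_mapping.lookup z e" and J = "edges - tree",
          OF simplicial_complex_clique_complex, rotated 4])
       (rule finite_Diff[OF finite_cliques], simp add: lookup_add, simp,
        rule non_tree_coefficients_detect, assumption, assumption)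
  moreover have "edges \<subseteq> good \<union> tree \<union> (\<Union>\<tau>\<in>triangles. {e. e \<subseteq> \<tau> \<and> card e = 2})"
    by (auto simp: good_def cliques_def)
  then have "card edges \<le> card (good \<union> tree \<union> (\<Union>\<tau>\<in>triangles. {e. e \<subseteq> \<tau> \<and> card e = 2}))"
    using finite_cliques finite_subset[OF tree_subset] 
    by (intro card_mono) (auto simp: good_def cliques_def)
  moreover have "\<dots> \<le> card good + card tree + card (\<Union>\<tau>\<in>triangles. {e. e \<subseteq> \<tau> \<and> card e = 2})"
    by (intro order.trans[OF card_Un_le] add_mono card_Un_le order.refl)
  moreover have "card (\<Union>\<tau>\<in>triangles. {e. e \<subseteq> \<tau> \<and> card e = 2}) \<le> (\<Sum>\<tau>\<in>triangles. card {e. e \<subseteq> \<tau> \<and> card e = 2})"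
    by (intro card_UN_le finite_cliques)
  moreover have "(\<Sum>\<tau>\<in>triangles. card {e. e \<subseteq> \<tau> \<and> card e = 2}) = (\<Sum>\<tau>\<in>triangles. 3)"
    by (intro sum.cong) (auto simp: cliques_def n_subsets eval_nat_numeral)
  ultimately show ?thesis
    using card_tree by simp
qed

end

section \<open>Multigraphs built by attaching vertices\<close>

definition out_degree :: "multigraph \<Rightarrow> nat \<Rightarrow> nat" where
  "out_degree E v = size {#e \<in># E. fst e = v#}"

definition in_degree :: "multigraph \<Rightarrow> nat \<Rightarrow> nat" where
  "in_degree E v = size {#e \<in># E. snd e = v#}"

text \<open>In this state, \<open>k\<close> edges of the vertex \<open>Suc T\<close> have been added to a graph on \<open>{1..T}\<close>.\<close>

definition pa_state :: "nat \<Rightarrow> nat \<Rightarrow> nat \<Rightarrow> multigraph \<Rightarrow> bool" where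
  "pa_state m T k E \<longleftrightarrow>
     (\<forall>u v. (u, v) \<in># E \<longrightarrow> 1 \<le> v \<and> v < u \<and> u \<le> Suc T) \<and>
     (\<forall>u\<in>{2..T}. out_degree E u = m) \<and> out_degree E (Suc T) = k"

text \<open>In a \<open>pa_state\<close> edges point to smaller labels, so a triple lists its
  vertices in decreasing order and each triangle appears once, whatever its edge
  multiplicities.\<close>

definition triangle_triples :: "multigraph \<Rightarrow> (nat \<times> nat \<times> nat) set" where
  "triangle_triples E = {(a, b, c). (a, b) \<in># E \<and> (a, c) \<in># E \<and> (b, c) \<in># E}"

text \<open>Serves as a bound for the gap between \<open>(m - 1) * (T - 1)\<close> and the first
  Betti number.\<close>

definition defect :: "multigraph \<Rightarrow> nat" where
  "defect E = (size E - card (set_mset E)) + 3 * card (triangle_triples E)"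

lemma pa_state_edge:
  "pa_state m T k E \<Longrightarrow> (u, v) \<in># E \<Longrightarrow> 1 \<le> v \<and> v < u \<and> u \<le> Suc T"
  by (auto simp: pa_state_def)

lemma filter_mset_eq_empty_iff: "filter_mset P M = {#} \<longleftrightarrow> (\<forall>x\<in>#M. \<not> P x)"
  by (induction M) auto

lemma card_set_mset_le: "card (set_mset M) \<le> size M"
  by (induction M) (auto intro: order.trans[OF card_insert_le_m1] simp: card_insert_if)

lemma size_filter_mset_add_mset:
  "size (filter_mset P (add_mset x M)) = size (filter_mset P M) + of_bool (P x)"
  by simp

lemma sum_size_filter_mset:
  assumes "finite A"
  shows "(\<Sum>x\<in>A. size {#e \<in># E. f e = x#}) = size {#e \<in># E. f e \<in> A#}"
proof (induction E)
  case (add e E)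
  have "(\<Sum>x\<in>A. of_bool (f e = x)) = (of_bool (f e \<in> A) :: nat)"
    using assms by (simp add: of_bool_def)
  with add show ?case
    unfolding size_filter_mset_add_mset sum.distrib by simp
qed simp

lemma sum_mset_eq_sum_count:
  "(\<Sum>e\<in>#M. f e) = (\<Sum>e\<in>set_mset M. of_nat (count M e) * (f e :: 'a :: comm_semiring_1))"
proof (induction M)
  case (add a M)
  have "(\<Sum>e\<in>set_mset (add_mset a M). of_nat (count (add_mset a M) e) * f e)
      = (\<Sum>e\<in>set_mset (add_mset a M). (if e = a then f a else 0) + of_nat (count M e) * f e)"
    by (intro sum.cong) (auto simp: algebra_simps)
  also have "\<dots> = f a + (\<Sum>e\<in>set_mset (add_mset a M). of_nat (count M e) * f e)"
    by (simp add: sum.distrib)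
  also have "(\<Sum>e\<in>set_mset (add_mset a M). of_nat (count M e) * f e) = (\<Sum>e\<in>set_mset M. of_nat (count M e) * f e)"
    by (intro sum.mono_neutral_right) (auto simp: not_in_iff)
  finally show ?case using add by simp
qed simp

lemma out_degree_root:
  assumes "pa_state m T k E" "T \<ge> 1"
  shows "out_degree E 1 = 0"
  using assms by (fastforce simp: out_degree_def pa_state_def filter_mset_eq_empty_iff)

lemma size_pa_state:
  assumes "pa_state m T k E" "T \<ge> 1"
  shows "size E = m * (T - 1) + k"
proof -
  have "filter_mset (\<lambda>e. fst e \<in> {2..Suc T}) E = E"
    unfolding filter_mset_eq_conv using pa_state_edge[OF assms(1)] by fastforce
  then have "size E = (\<Sum>u\<in>{2..Suc T}. out_degree E u)"
    unfolding out_degree_def by (subst sum_size_filter_mset) auto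
  also have "\<dots> = (\<Sum>u\<in>{2..T}. m) + k"
    using assms by (simp add: pa_state_def atLeastAtMostSuc_conv)
  finally show ?thesis using assms(2) by (simp add: mult.commute)
qed

text \<open>Edges always point to the smaller label, so the direction can be recovered from the
  unordered pair.\<close>

lemma simple_edges_lower:
  assumes "pa_state m T k E" "u < v"
  shows "{u, v} \<in> simple_edges E \<longleftrightarrow> (v, u) \<in># E"
  using assms pa_state_edge[OF assms(1)] unfolding simple_edges_def
  by (fastforce simp: doubleton_eq_iff)

text \<open>The smaller neighbours are among the heads of the edges leaving \<open>v\<close>, and at
  most \<open>m\<close> edges leave a vertex.\<close>

lemma card_lower_nbrs_le:
  assumes "pa_state m T 0 E" "v \<in> {1..T}"
  shows "card (lower_nbrs {1..T} (simple_edges E) v) \<le> m"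
proof -
  have "lower_nbrs {1..T} (simple_edges E) v \<subseteq> snd ` set_mset {#e \<in># E. fst e = v#}"
    using simple_edges_lower[OF assms(1)] by (force simp: lower_nbrs_def)
  then have "card (lower_nbrs {1..T} (simple_edges E) v) \<le> card (snd ` set_mset {#e \<in># E. fst e = v#})"
    by (intro card_mono) auto
  also have "\<dots> \<le> card (set_mset {#e \<in># E. fst e = v#})"
    by (intro card_image_le) auto
  also have "\<dots> \<le> out_degree E v"
    unfolding out_degree_def by (metis card_set_mset_le)
  also have "\<dots> \<le> m"
    using assms out_degree_root[OF assms(1)] by (cases "v = 1") (auto simp: pa_state_def)
  finally show ?thesis .
qed

text \<open>With \<open>k = 0\<close> no edge touches the pending vertex \<open>Suc T\<close>, so
  the state describes a graph on \<open>{1..T}\<close>.\<close>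

lemma pa_state_top:
  assumes "pa_state m T 0 E" "(u, v) \<in># E"
  shows "u \<le> T"
proof (rule ccontr)
  assume "\<not> u \<le> T"
  then have "u = Suc T" using pa_state_edge[OF assms] by auto
  then have "(Suc T, v) \<in># {#e \<in># E. fst e = Suc T#}"
    using assms(2) by simp
  moreover have "out_degree E (Suc T) = 0"
    using assms(1) by (simp add: pa_state_def)
  ultimately show False
    unfolding out_degree_def size_eq_0_iff_empty by simp
qed

lemma betti_eq_0_pa_state:
  assumes "pa_state m T 0 E" "m < 2 * q"
  shows "betti q (clique_complex {1..T} (simple_edges E)) = 0"
  using assms card_lower_nbrs_le[OF assms(1)]
  by (intro betti_clique_complex_eq_0) (auto intro: order.strict_trans1)

text \<open>As \<open>m > 0\<close>, each vertex from 2 on has an outgoing edge; the head of one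
  serves as parent.\<close>

lemma rooted_graph_pa_state:
  assumes "pa_state m T 0 E" "m > 0" "T \<ge> 1"
  obtains parent where "rooted_graph T (simple_edges E) parent"
proof -
  have "\<exists>v. (t, v) \<in># E" if "2 \<le> t" "t \<le> T" for t
  proof -
    have "out_degree E t = m"
      using assms(1) that by (auto simp: pa_state_def)
    then have "{#e \<in># E. fst e = t#} \<noteq> {#}"
      using assms(2) unfolding out_degree_def by (intro notI) simp
    then obtain e where "e \<in># E" "fst e = t"
      by (auto simp: filter_mset_eq_empty_iff)
    then show ?thesis
      by (cases e) auto
  qed
  then obtain parent where "\<And>t. 2 \<le> t \<Longrightarrow> t \<le> T \<Longrightarrow> (t, parent t) \<in># E"
    by metis
  then have "rooted_graph T (simple_edges E) parent"
    using assms pa_state_edge[OF assms(1)] simple_edges_lower[OF assms(1)]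
    by unfold_locales auto
  then show ?thesis by (rule that)
qed

lemma card_edges_pa_state:
  assumes "pa_state m T 0 E"
  shows "card (cliques {1..T} (simple_edges E) 2) = card (set_mset E)"
proof -
  let ?f = "\<lambda>(u, v). {u, v}"
  have "inj_on ?f (set_mset E)"
  proof (rule inj_onI)
    fix d e assume "d \<in># E" "e \<in># E" "?f d = ?f e"
    then show "d = e"
      using pa_state_edge[OF assms, of "fst d" "snd d"] pa_state_edge[OF assms, of "fst e" "snd e"]
      by (auto simp: doubleton_eq_iff split: prod.splits)
  qed
  moreover have "?f ` set_mset E = cliques {1..T} (simple_edges E) 2"
  proof (intro equalityI subsetI)
    fix \<sigma> assume "\<sigma> \<in> ?f ` set_mset E"
    then obtain u v where "(u, v) \<in># E" "\<sigma> = {u, v}" by auto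
    then show "\<sigma> \<in> cliques {1..T} (simple_edges E) 2"
      using pa_state_edge[OF assms] pa_state_top[OF assms] simple_edges_lower[OF assms, of v u]
      by (fastforce simp: cliques_def insert_commute)
  next
    fix \<sigma> assume "\<sigma> \<in> cliques {1..T} (simple_edges E) 2"
    then have "\<sigma> \<in> simple_edges E"
      by (auto simp: cliques_def card_2_iff)
    then show "\<sigma> \<in> ?f ` set_mset E"
      by (force simp: simple_edges_def)
  qed
  ultimately show ?thesis
    using card_image by metis
qed

lemma finite_triangle_triples: "finite (triangle_triples E)"
proof (rule finite_subset)
  show "triangle_triples E \<subseteq> (\<lambda>((a, b), c). (a, b, c)) ` (set_mset E \<times> snd ` set_mset E)"
    by (force simp: triangle_triples_def image_iff)
qed simp

lemma card_triangles_le: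
  assumes "pa_state m T 0 E"
  shows "card (cliques {1..T} (simple_edges E) 3) \<le> card (triangle_triples E)"
proof -
  have "cliques {1..T} (simple_edges E) 3 \<subseteq> (\<lambda>(a, b, c). {a, b, c}) ` triangle_triples E"
  proof
    fix \<sigma> assume \<sigma>: "\<sigma> \<in> cliques {1..T} (simple_edges E) 3"
    then have fin: "finite \<sigma>" and card: "card \<sigma> = 3"
      by (auto simp: cliques_def)
    have "length (sorted_list_of_set \<sigma>) = Suc (Suc (Suc 0))"
      using card by simp
    then obtain c b a where list: "sorted_list_of_set \<sigma> = [c, b, a]"
      by (metis length_0_conv length_Suc_conv)
    have "sorted_wrt (<) (sorted_list_of_set \<sigma>)" by simp
    then have abc: "c < b" "b < a" "c < a" unfolding list by auto
    have "\<sigma> = {a, b, c}"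
      using set_sorted_list_of_set[OF fin] unfolding list by auto
    moreover from this have "(a, b, c) \<in> triangle_triples E"
      using \<sigma> abc simple_edges_lower[OF assms, of b a] simple_edges_lower[OF assms, of c a]
        simple_edges_lower[OF assms, of c b]
      by (auto simp: cliques_def triangle_triples_def insert_commute)
    ultimately show "\<sigma> \<in> (\<lambda>(a, b, c). {a, b, c}) ` triangle_triples E"
      by force
  qed
  then show ?thesis
    using finite_triangle_triples by (metis surj_card_le)
qed

lemma betti_0_pa_state:
  assumes "pa_state m T 0 E" "m > 0" "T \<ge> 1"
  shows "betti 0 (clique_complex {1..T} (simple_edges E)) = 1"
proof -
  obtain parent where "rooted_graph T (simple_edges E) parent"
    using rooted_graph_pa_state[OF assms] .
  then show ?thesis by (rule rooted_graph.betti_0)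
qed

lemma betti_1_pa_state:
  assumes "pa_state m T 0 E" "m > 0" "T \<ge> 1"
  shows "betti 1 (clique_complex {1..T} (simple_edges E)) \<le> (m - 1) * (T - 1)"
    and "(m - 1) * (T - 1) \<le> betti 1 (clique_complex {1..T} (simple_edges E)) + defect E"
proof -
  obtain parent where "rooted_graph T (simple_edges E) parent"
    using rooted_graph_pa_state[OF assms] .
  then interpret rooted_graph T "simple_edges E" parent .
  \<comment> \<open>Isolates the \<open>T - 1\<close> edges that cancel against the spanning tree in
    both estimates.\<close>
  have size: "size E = (m - 1) * (T - 1) + (T - 1)"
    using size_pa_state[OF assms(1,3)] assms(2) by (cases m) auto
  have "card (set_mset E) \<le> size E" by (rule card_set_mset_le)
  then show "betti 1 (clique_complex {1..T} (simple_edges E)) \<le> (m - 1) * (T - 1)"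
    "(m - 1) * (T - 1) \<le> betti 1 (clique_complex {1..T} (simple_edges E)) + defect E"
    using betti_1_le betti_1_ge card_edges_pa_state[OF assms(1)] card_triangles_le[OF assms(1)] size
    unfolding defect_def by linarith+
qed

text \<open>Only earlier edges from \<open>Suc T\<close> matter: the new edge is a repetition if one
  of them ends in \<open>x\<close>, and closes a triangle if one of them ends in a neighbour of
  \<open>x\<close>.\<close>

lemma defect_add_edge:
  assumes "pa_state m T k E" "x \<le> T"
  shows "defect (add_mset (Suc T, x) E) \<le> defect E
    + (\<Sum>e\<in>#{#e \<in># E. fst e = Suc T#}.
         of_bool (snd e = x) + 3 * (count E (x, snd e) + count E (snd e, x)))"
proof -
  let ?t = "Suc T"
  let ?M = "{#e \<in># E. fst e = ?t#}"
  let ?E' = "add_mset (?t, x) E"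
  define N where "N = {y. (?t, y) \<in># E \<and> ((x, y) \<in># E \<or> (y, x) \<in># E)}"
  have lt: "(u, v) \<in># E \<Longrightarrow> v < u \<and> u \<le> ?t" for u v
    using pa_state_edge[OF assms(1)] by auto
  have "finite (snd ` set_mset E)" by simp
  then have fin: "finite N"
    by (rule rev_finite_subset) (force simp: N_def image_iff)
  \<comment> \<open>The third vertex \<open>y\<close> determines the new triangle; the case
    distinction orders its vertices.\<close>
  define g where "g y = (if (x, y) \<in># E then (?t, x, y) else (?t, y, x))" for y
  have "triangle_triples ?E' \<subseteq> triangle_triples E \<union> g ` N"
  proof
    fix \<tau> assume "\<tau> \<in> triangle_triples ?E'"
    then obtain a b c where abc: "\<tau> = (a, b, c)" "(a, b) \<in># ?E'" "(a, c) \<in># ?E'" "(b, c) \<in># ?E'"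
      by (auto simp: triangle_triples_def)
    \<comment> \<open>No edge ends in \<open>Suc T\<close>, so the new edge cannot be the one
      opposite the first vertex of the triple.\<close>
    have "(b, c) \<noteq> (?t, x)"
      using abc(2) lt[of a b] assms(2) by auto
    then have bc: "(b, c) \<in># E"
      using abc(4) by auto
    note lt_bc = lt[OF bc]
    show "\<tau> \<in> triangle_triples E \<union> g ` N"
    proof (cases "\<tau> \<in> triangle_triples E")
      case False
      then consider "a = ?t" "b = x" | "a = ?t" "c = x" "b \<noteq> x"
        using abc bc by (auto simp: triangle_triples_def)
      then show ?thesis
      proof cases
        case 1
        then have "c \<in> N" "g c = \<tau>"
          using abc bc lt_bc by (auto simp: N_def g_def)
        then show ?thesis by blast
      next
        case 2
        then have "(x, b) \<notin># E" using lt[of x b] lt_bc by auto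
        then have "b \<in> N" "g b = \<tau>"
          using 2 abc bc lt_bc by (auto simp: N_def g_def)
        then show ?thesis by blast
      qed
    qed simp
  qed
  then have "card (triangle_triples ?E') \<le> card (triangle_triples E \<union> g ` N)"
    using fin finite_triangle_triples by (intro card_mono) auto
  also have "\<dots> \<le> card (triangle_triples E) + card N"
    using card_image_le[OF fin, of g] card_Un_le[of "triangle_triples E" "g ` N"] by linarith
  finally have tri: "card (triangle_triples ?E') \<le> card (triangle_triples E) + card N" .
  have "card N = (\<Sum>y\<in>N. 1)" by simp
  \<comment> \<open>Each \<open>y\<close> in \<open>N\<close> is the head of an earlier edge and
    adjacent to \<open>x\<close>, so both factors are positive.\<close>
  also have "\<dots> \<le> (\<Sum>y\<in>N. count E (?t, y) * (count E (x, y) + count E (y, x)))"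
    by (intro sum_mono) (auto simp: N_def Suc_le_eq)
  also have "\<dots> = (\<Sum>e\<in>Pair ?t ` N. count E e * (count E (x, snd e) + count E (snd e, x)))"
    by (subst sum.reindex) (auto simp: inj_on_def)
  also have "\<dots> = (\<Sum>e\<in>Pair ?t ` N. count ?M e * (count E (x, snd e) + count E (snd e, x)))"
    by (intro sum.cong) auto
  also have "\<dots> \<le> (\<Sum>e\<in>set_mset ?M. count ?M e * (count E (x, snd e) + count E (snd e, x)))"
    by (intro sum_mono2) (auto simp: N_def)
  also have "\<dots> = (\<Sum>e\<in>#?M. count E (x, snd e) + count E (snd e, x))"
    by (simp add: sum_mset_eq_sum_count)
  finally have N: "card N \<le> (\<Sum>e\<in>#?M. count E (x, snd e) + count E (snd e, x))" .
  \<comment> \<open>The excess grows by one only if \<open>(?t, x)\<close> is present already, and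
    that copy contributes to the sum.\<close>
  have rep: "size ?E' - card (set_mset ?E') \<le> (size E - card (set_mset E)) + (\<Sum>e\<in>#?M. of_bool (snd e = x))"
  proof (cases "(?t, x) \<in># E")
    case True
    then have "(?t, x) \<in># ?M" by simp
    then obtain M where "?M = add_mset (?t, x) M"
      by (metis insert_DiffM)
    then have "1 \<le> (\<Sum>e\<in>#?M. of_bool (snd e = x) :: nat)" by simp
    then show ?thesis
      using True by (simp add: insert_absorb)
  qed simp
  have "defect ?E' \<le> defect E + (\<Sum>e\<in>#?M. of_bool (snd e = x)) + 3 * (\<Sum>e\<in>#?M. count E (x, snd e) + count E (snd e, x))"
    using tri N rep unfolding defect_def by linarith
  also have "\<dots> = defect E + (\<Sum>e\<in>#?M. of_bool (snd e = x) + 3 * (count E (x, snd e) + count E (snd e, x)))"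
    by (simp add: sum_mset.distrib sum_mset_distrib_left)
  finally show ?thesis .
qed

section \<open>Adding one random edge\<close>

text \<open>Counting \<open>m\<close> for the out-edges from the start keeps the weight of the new
  vertex constant while its edges are attached.\<close>

definition weight :: "nat \<Rightarrow> multigraph \<Rightarrow> nat \<Rightarrow> real" where
  "weight m E v = real m + real (in_degree E v)"

definition weight_square_sum :: "nat \<Rightarrow> nat \<Rightarrow> multigraph \<Rightarrow> real" where
  "weight_square_sum m T E = (\<Sum>v\<in>{1..T}. (weight m E v)\<^sup>2)"

definition edge_weight_sum :: "nat \<Rightarrow> multigraph \<Rightarrow> real" where
  "edge_weight_sum m E = (\<Sum>e\<in>#E. weight m E (fst e) * weight m E (snd e))"

definition edge_prob :: "real \<Rightarrow> nat \<Rightarrow> multigraph \<Rightarrow> nat \<Rightarrow> real" where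
  "edge_prob \<delta> T E x =
     (\<delta> + real (total_degree E x)) / (\<Sum>v\<in>{1..T}. \<delta> + real (total_degree E v))"

lemma total_degree_eq: "total_degree E v = out_degree E v + in_degree E v"
  by (simp add: total_degree_def out_degree_def in_degree_def)

lemma in_degree_add_mset: "in_degree (add_mset (u, x) E) v = in_degree E v + of_bool (x = v)"
  by (simp add: in_degree_def)

lemma out_degree_add_mset: "out_degree (add_mset (u, x) E) v = out_degree E v + of_bool (u = v)"
  by (simp add: out_degree_def)

lemma weight_add_mset: "weight m (add_mset (u, x) E) v = weight m E v + of_bool (x = v)"
  by (simp add: weight_def in_degree_add_mset)

lemma weight_nonneg: "weight m E v \<ge> 0"
  by (simp add: weight_def)

lemma sum_sum_mset_swap:
  "(\<Sum>x\<in>A. \<Sum>e\<in>#M. f x e) = (\<Sum>e\<in>#M. \<Sum>x\<in>A. f x e :: 'a::comm_monoid_add)"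
  by (induction M) (simp_all add: sum.distrib)

lemma sum_mset_mono_mem:
  "(\<And>e. e \<in># M \<Longrightarrow> f e \<le> g e) \<Longrightarrow> (\<Sum>e\<in>#M. f e) \<le> (\<Sum>e\<in>#M. g e :: real)"
  by (induction M) (auto intro: add_mono)

text \<open>Vertex pairs counted with multiplicity are the edges with both ends in \<open>A\<close>;
  the remaining edges add nonnegative terms.\<close>

lemma sum_count_le_sum_mset:
  assumes "finite A" "\<And>x y. f x y \<ge> (0::real)"
  shows "(\<Sum>x\<in>A. \<Sum>y\<in>A. real (count E (x, y)) * f x y) \<le> (\<Sum>e\<in>#E. f (fst e) (snd e))"
proof -
  have "(\<Sum>x\<in>A. \<Sum>y\<in>A. real (count E (x, y)) * f x y)
      = (\<Sum>e\<in>A \<times> A. real (count E e) * f (fst e) (snd e))"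
    by (simp add: sum.cartesian_product case_prod_beta)
  also have "\<dots> = (\<Sum>e\<in>A \<times> A \<inter> set_mset E. real (count E e) * f (fst e) (snd e))"
    using assms(1) by (intro sum.mono_neutral_right) (auto simp: not_in_iff)
  also have "\<dots> \<le> (\<Sum>e\<in>set_mset E. real (count E e) * f (fst e) (snd e))"
    using assms(2) by (intro sum_mono2) auto
  also have "\<dots> = (\<Sum>e\<in>#E. f (fst e) (snd e))"
    by (simp add: sum_mset_eq_sum_count)
  finally show ?thesis .
qed

lemma expectation_bind_le:
  fixes h :: "'b \<Rightarrow> real"
  assumes "finite (set_pmf p)" "\<And>x. x \<in> set_pmf p \<Longrightarrow> finite (set_pmf (f x))"
    and "\<And>x. x \<in> set_pmf p \<Longrightarrow> measure_pmf.expectation (f x) h \<le> g x"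
  shows "measure_pmf.expectation (bind_pmf p f) h \<le> measure_pmf.expectation p g"
proof -
  have "measure_pmf.expectation (bind_pmf p f) h
      = (\<Sum>x\<in>set_pmf p. pmf p x *\<^sub>R measure_pmf.expectation (f x) h)"
    using assms by (intro pmf_expectation_bind) auto
  also have "\<dots> \<le> (\<Sum>x\<in>set_pmf p. pmf p x *\<^sub>R g x)"
    using assms(3) by (intro sum_mono scaleR_left_mono) auto
  also have "\<dots> = measure_pmf.expectation p g"
    using assms(1) by (subst integral_measure_pmf[where A = "set_pmf p"]) auto
  finally show ?thesis .
qed

lemma pa_state_in_degree_new:
  assumes "pa_state m T k E"
  shows "in_degree E (Suc T) = 0"
  using pa_state_edge[OF assms] by (fastforce simp: in_degree_def filter_mset_eq_empty_iff)

lemma pa_state_add_edge: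
  assumes "pa_state m T k E" "x \<in> {1..T}"
  shows "pa_state m T (Suc k) (add_mset (Suc T, x) E)"
  using assms by (auto simp: pa_state_def out_degree_add_mset)

lemma pa_state_Suc:
  assumes "pa_state m T m E" "T \<ge> 1"
  shows "pa_state m (Suc T) 0 E"
proof -
  have "out_degree E (Suc (Suc T)) = 0"
    using pa_state_edge[OF assms(1)] by (fastforce simp: out_degree_def filter_mset_eq_empty_iff)
  then show ?thesis
    using assms by (auto simp: pa_state_def le_Suc_eq)
qed

locale pa_parameters =
  fixes m :: nat and \<delta> :: real
  assumes m: "m > 0" and \<delta>: "- real m < \<delta>" "\<delta> < 0"
begin

text \<open>The normalising constant for the first edge of \<open>Suc T\<close>; each further edge
  of that vertex raises the constant by 1.\<close>

definition total_weight :: "nat \<Rightarrow> real" where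
  "total_weight T = (2 * real m + \<delta>) * real T - 2 * real m"

text \<open>The least value, \<open>2 * (m + \<delta>)\<close> at \<open>T = 2\<close>, is positive
  because \<open>\<delta> > - m\<close>.\<close>

lemma total_weight_pos: "T \<ge> 2 \<Longrightarrow> total_weight T > 0"
proof -
  assume "T \<ge> 2"
  then have "(2 * real m + \<delta>) * 2 \<le> (2 * real m + \<delta>) * real T"
    using \<delta> m by (intro mult_left_mono) auto
  then show ?thesis using \<delta> by (simp add: total_weight_def)
qed

context
  fixes T k :: nat and E :: multigraph
  assumes T: "T \<ge> 2" and state: "pa_state m T k E" and k: "k \<le> m"
begin

lemma total_degree_ge:
  assumes "v \<in> {1..T}"
  shows "m \<le> total_degree E v"
proof (cases "v = 1")
  case True
  \<comment> \<open>All \<open>m\<close> edges of vertex 2 end in vertex 1, their only possible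
    target.\<close>
  have "out_degree E 2 = size {#e \<in># {#e \<in># E. fst e = 2#}. snd e = 1#}"
    unfolding out_degree_def using pa_state_edge[OF state]
    by (subst filter_mset_eq_conv[THEN iffD2]) fastforce+
  also have "\<dots> \<le> in_degree E 1"
    unfolding in_degree_def by (intro size_mset_mono multiset_filter_mono) simp
  finally show ?thesis
    using True T state by (simp add: total_degree_eq pa_state_def)
next
  case False
  then show ?thesis
    using assms state by (auto simp: total_degree_eq pa_state_def)
qed

lemma degree_weight_pos: "v \<in> {1..T} \<Longrightarrow> \<delta> + real (total_degree E v) > 0"
  using total_degree_ge[of v] \<delta> by linarith

text \<open>Here \<open>\<delta> < 0\<close> enters, together with the bound \<open>m\<close> on
  every out-degree.\<close>

lemma total_degree_le_weight:
  assumes "v \<in> {1..T}"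
  shows "\<delta> + real (total_degree E v) \<le> weight m E v"
proof -
  have "out_degree E v \<le> m"
    using assms state T out_degree_root[OF state] by (cases "v = 1") (auto simp: pa_state_def)
  then show ?thesis
    using \<delta> by (simp add: weight_def total_degree_eq)
qed

text \<open>Out-degrees and in-degrees over \<open>{1..T}\<close> sum to \<open>m * (T - 1)\<close>
  and \<open>m * (T - 1) + k\<close>; the \<open>k\<close> edges of the pending vertex only increase
  the sum.\<close>

lemma total_weight_le: "total_weight T \<le> (\<Sum>v\<in>{1..T}. \<delta> + real (total_degree E v))"
proof -
  have "{1..T} = insert 1 {2..T}"
    using T by auto
  then have "(\<Sum>v\<in>{1..T}. out_degree E v) = m * (T - 1)"
    using state out_degree_root[OF state] T by (simp add: pa_state_def)
  moreover have "(\<Sum>v\<in>{1..T}. in_degree E v) = m * (T - 1) + k"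
  proof -
    have "filter_mset (\<lambda>e. snd e \<in> {1..T}) E = E"
      unfolding filter_mset_eq_conv using pa_state_edge[OF state] by fastforce
    then have "(\<Sum>v\<in>{1..T}. in_degree E v) = size E"
      unfolding in_degree_def by (subst sum_size_filter_mset) auto
    then show ?thesis using size_pa_state[OF state] T by simp
  qed
  ultimately have "(\<Sum>v\<in>{1..T}. total_degree E v) = 2 * (m * (T - 1)) + k"
    unfolding total_degree_eq sum.distrib by simp
  then have "(\<Sum>v\<in>{1..T}. real (total_degree E v)) = real (2 * (m * (T - 1)) + k)"
    unfolding of_nat_sum[symmetric] by simp
  also have "\<dots> = 2 * real m * real T - 2 * real m + real k"
    using T by (simp add: of_nat_diff right_diff_distrib)
  finally show ?thesis
    by (simp add: sum.distrib total_weight_def algebra_simps)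
qed

lemma set_pmf_edge: "set_pmf (weighted_pmf {1..T} (\<lambda>v. \<delta> + real (total_degree E v))) = {1..T}"
proof -
  have "(\<Sum>v\<in>{1..T}. \<delta> + real (total_degree E v)) > 0"
    using total_weight_le total_weight_pos[OF T] by linarith
  then show ?thesis
    using T degree_weight_pos unfolding set_eq_iff set_pmf_iff
    by (subst pmf_weighted_pmf) (auto, force)
qed

lemma edge_prob_nonneg: "x \<in> {1..T} \<Longrightarrow> 0 \<le> edge_prob \<delta> T E x"
  unfolding edge_prob_def using total_weight_le total_weight_pos[OF T] degree_weight_pos[of x]
  by (intro divide_nonneg_nonneg) auto

lemma sum_edge_prob: "(\<Sum>x\<in>{1..T}. edge_prob \<delta> T E x) = 1"
  unfolding edge_prob_def using total_weight_le total_weight_pos[OF T]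
  by (simp flip: sum_divide_distrib)

lemma edge_prob_le:
  assumes "x \<in> {1..T}"
  shows "edge_prob \<delta> T E x \<le> weight m E x / total_weight T"
  unfolding edge_prob_def
  using total_weight_le total_weight_pos[OF T] total_degree_le_weight[OF assms] weight_nonneg
  by (intro frac_le) auto

lemma finite_set_pmf_add_edge: "finite (set_pmf (add_edge \<delta> (Suc T) E))"
  using set_pmf_edge by (simp add: add_edge_def)

lemma set_pmf_add_edge: "set_pmf (add_edge \<delta> (Suc T) E) = (\<lambda>x. add_mset (Suc T, x) E) ` {1..T}"
  using set_pmf_edge by (simp add: add_edge_def)

lemma expectation_add_edge:
  "measure_pmf.expectation (add_edge \<delta> (Suc T) E) (h :: _ \<Rightarrow> real)
    = (\<Sum>x\<in>{1..T}. edge_prob \<delta> T E x * h (add_mset (Suc T, x) E))"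
proof -
  have "measure_pmf.expectation (add_edge \<delta> (Suc T) E) h
      = (\<Sum>x\<in>{1..T}. h (add_mset (Suc T, x) E) * pmf (weighted_pmf {1..T} (\<lambda>v. \<delta> + real (total_degree E v))) x)"
    unfolding add_edge_def using set_pmf_edge
    by (simp, subst integral_measure_pmf_real[where A = "{1..T}"]) auto
  also have "\<dots> = (\<Sum>x\<in>{1..T}. edge_prob \<delta> T E x * h (add_mset (Suc T, x) E))"
    using T degree_weight_pos
    by (intro sum.cong refl, subst pmf_weighted_pmf) (auto simp: edge_prob_def)
  finally show ?thesis .
qed

lemma sum_edge_prob_add_const: "(\<Sum>x\<in>{1..T}. edge_prob \<delta> T E x * (c + f x)) = c + (\<Sum>x\<in>{1..T}. edge_prob \<delta> T E x * f x)"
  using sum_edge_prob by (simp add: distrib_left sum.distrib flip: sum_distrib_right)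

lemma sum_edge_prob_mono:
  assumes "\<And>x. x \<in> {1..T} \<Longrightarrow> edge_prob \<delta> T E x \<le> c x" "\<And>x. x \<in> {1..T} \<Longrightarrow> f x \<ge> 0"
  shows "(\<Sum>x\<in>{1..T}. edge_prob \<delta> T E x * f x) \<le> (\<Sum>x\<in>{1..T}. c x * f x)"
  using assms by (intro sum_mono mult_right_mono) auto

lemma expected_weight_le:
  "(\<Sum>x\<in>{1..T}. edge_prob \<delta> T E x * weight m E x) \<le> weight_square_sum m T E / total_weight T"
  using sum_edge_prob_mono[OF edge_prob_le, of "weight m E"] weight_nonneg
  by (simp add: weight_square_sum_def power2_eq_square sum_divide_distrib)

text \<open>Choosing \<open>x\<close> raises its square by \<open>2 * weight m E x + 1\<close>. The
  sum stays over \<open>{1..T}\<close>; the new vertex enters it only after its \<open>m\<close>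
  edges are attached.\<close>

lemma expectation_weight_square_sum:
  "measure_pmf.expectation (add_edge \<delta> (Suc T) E) (weight_square_sum m T)
    \<le> weight_square_sum m T E + 2 * weight_square_sum m T E / total_weight T + 1"
proof -
  have "weight_square_sum m T (add_mset (Suc T, x) E) = weight_square_sum m T E + (2 * weight m E x + 1)"
    if "x \<in> {1..T}" for x
  proof -
    have "weight_square_sum m T (add_mset (Suc T, x) E)
        = (\<Sum>v\<in>{1..T}. (weight m E v)\<^sup>2 + (if x = v then 2 * weight m E v + 1 else 0))"
      unfolding weight_square_sum_def weight_add_mset
      by (intro sum.cong) (auto simp: power2_eq_square algebra_simps)
    then show ?thesis
      using that by (simp add: sum.distrib weight_square_sum_def)
  qed
  then have "measure_pmf.expectation (add_edge \<delta> (Suc T) E) (weight_square_sum m T)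
      = (\<Sum>x\<in>{1..T}. edge_prob \<delta> T E x * (weight_square_sum m T E + (2 * weight m E x + 1)))"
    unfolding expectation_add_edge by (intro sum.cong) auto
  also have "\<dots> = weight_square_sum m T E + 2 * (\<Sum>x\<in>{1..T}. edge_prob \<delta> T E x * weight m E x) + 1"
    unfolding sum_edge_prob_add_const add.commute[of _ 1]
    by (simp add: sum_distrib_left mult_ac)
  finally show ?thesis
    using expected_weight_le by simp
qed

text \<open>Choosing \<open>x\<close> acts in two ways: every edge at \<open>x\<close> gains the
  weight of its other end, and the new edge contributes
  \<open>m * (weight m E x + 1)\<close>.\<close>

lemma expectation_edge_weight_sum:
  "measure_pmf.expectation (add_edge \<delta> (Suc T) E) (edge_weight_sum m)
    \<le> edge_weight_sum m E + 2 * edge_weight_sum m E / total_weight T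
      + real m * weight_square_sum m T E / total_weight T + real m"
proof -
  let ?w = "weight m E"
  define g where "g x e = of_bool (x = fst e) * ?w (snd e) + of_bool (x = snd e) * ?w (fst e)" for x e
  have step: "edge_weight_sum m (add_mset (Suc T, x) E)
      = edge_weight_sum m E + ((\<Sum>e\<in>#E. g x e) + (real m + real m * ?w x))" if "x \<in> {1..T}" for x
  proof -
    \<comment> \<open>An edge has distinct ends, so at most one of the two factors grows and no
      product of increments arises.\<close>
    have "weight m (add_mset (Suc T, x) E) (fst e) * weight m (add_mset (Suc T, x) E) (snd e)
        = ?w (fst e) * ?w (snd e) + g x e" if "e \<in># E" for e
      using pa_state_edge[OF state, of "fst e" "snd e"] that
      by (auto simp: weight_add_mset g_def algebra_simps)
    then have "(\<Sum>e\<in>#E. weight m (add_mset (Suc T, x) E) (fst e) * weight m (add_mset (Suc T, x) E) (snd e))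
        = (\<Sum>e\<in>#E. ?w (fst e) * ?w (snd e) + g x e)"
      by (intro arg_cong[where f = sum_mset] image_mset_cong)
    moreover have "weight m (add_mset (Suc T, x) E) (Suc T) = real m"
      using pa_state_in_degree_new[OF state] that by (simp add: weight_def in_degree_add_mset)
    moreover have "x \<noteq> Suc T" using that by simp
    ultimately show ?thesis
      by (simp add: edge_weight_sum_def weight_add_mset sum_mset.distrib algebra_simps)
  qed
  have pick: "(\<Sum>x\<in>{1..T}. edge_prob \<delta> T E x * of_bool (x = a)) \<le> ?w a / total_weight T" for a
  proof (cases "a \<in> {1..T}")
    case True
    then have "(\<Sum>x\<in>{1..T}. edge_prob \<delta> T E x * of_bool (x = a)) = edge_prob \<delta> T E a"
      by (simp add: of_bool_def if_distrib[of "(*) _"] cong: if_cong)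
    then show ?thesis using edge_prob_le[OF True] by simp
  next
    case False
    then have "(\<Sum>x\<in>{1..T}. edge_prob \<delta> T E x * of_bool (x = a)) = 0"
      by (intro sum.neutral) auto
    then show ?thesis
      using weight_nonneg total_weight_pos[OF T] by simp
  qed
  have "(\<Sum>x\<in>{1..T}. edge_prob \<delta> T E x * g x e) \<le> 2 * (?w (fst e) * ?w (snd e)) / total_weight T" for e
  proof -
    have "(\<Sum>x\<in>{1..T}. edge_prob \<delta> T E x * g x e)
        = (\<Sum>x\<in>{1..T}. edge_prob \<delta> T E x * of_bool (x = fst e)) * ?w (snd e)
        + (\<Sum>x\<in>{1..T}. edge_prob \<delta> T E x * of_bool (x = snd e)) * ?w (fst e)"
      by (simp only: g_def distrib_left sum.distrib sum_distrib_right mult.assoc)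
    also have "\<dots> \<le> ?w (fst e) / total_weight T * ?w (snd e) + ?w (snd e) / total_weight T * ?w (fst e)"
      by (intro add_mono mult_right_mono pick weight_nonneg)
    finally show ?thesis by (simp add: mult_ac)
  qed
  then have "(\<Sum>e\<in>#E. \<Sum>x\<in>{1..T}. edge_prob \<delta> T E x * g x e)
      \<le> (\<Sum>e\<in>#E. 2 * (?w (fst e) * ?w (snd e)) / total_weight T)"
    by (intro sum_mset_mono_mem)
  also have "\<dots> = (\<Sum>e\<in>#E. 2 / total_weight T * (?w (fst e) * ?w (snd e)))"
    by simp
  also have "\<dots> = 2 / total_weight T * edge_weight_sum m E"
    unfolding edge_weight_sum_def sum_mset_distrib_left ..
  also have "\<dots> = 2 * edge_weight_sum m E / total_weight T"
    by simp
  finally have cross: "(\<Sum>x\<in>{1..T}. edge_prob \<delta> T E x * (\<Sum>e\<in>#E. g x e)) \<le> 2 * edge_weight_sum m E / total_weight T"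
    unfolding sum_sum_mset_swap[symmetric] by (simp add: sum_mset_distrib_left)
  have "measure_pmf.expectation (add_edge \<delta> (Suc T) E) (edge_weight_sum m)
      = (\<Sum>x\<in>{1..T}. edge_prob \<delta> T E x * (edge_weight_sum m E + ((\<Sum>e\<in>#E. g x e) + (real m + real m * ?w x))))"
    unfolding expectation_add_edge using step by (intro sum.cong) auto
  also have "\<dots> = edge_weight_sum m E + (\<Sum>x\<in>{1..T}. edge_prob \<delta> T E x * (\<Sum>e\<in>#E. g x e))
      + (\<Sum>x\<in>{1..T}. edge_prob \<delta> T E x * (real m + real m * ?w x))"
    unfolding sum_edge_prob_add_const[where c = "edge_weight_sum m E"]
    by (simp only: distrib_left sum.distrib add.assoc)
  also have "(\<Sum>x\<in>{1..T}. edge_prob \<delta> T E x * (real m + real m * ?w x))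
      = real m + real m * (\<Sum>x\<in>{1..T}. edge_prob \<delta> T E x * ?w x)"
    unfolding sum_edge_prob_add_const by (simp add: sum_distrib_left mult_ac)
  also have "real m + real m * (\<Sum>x\<in>{1..T}. edge_prob \<delta> T E x * ?w x) \<le> real m + real m * (weight_square_sum m T E / total_weight T)"
    using expected_weight_le by (intro add_mono mult_left_mono) auto
  finally show ?thesis using cross by simp
qed

end

end

section \<open>Adding one random vertex\<close>

text \<open>What two new edges with heads \<open>x\<close> and \<open>y\<close> can add to the
  defect: 1 for a repetition and 3 for each edge between the heads.\<close>

definition defect_kernel :: "multigraph \<Rightarrow> nat \<Rightarrow> nat \<Rightarrow> real" where
  "defect_kernel E x y = of_bool (x = y) + 3 * (real (count E (x, y)) + real (count E (y, x)))"

lemma defect_kernel_nonneg: "defect_kernel E x y \<ge> 0"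
  by (simp add: defect_kernel_def)

text \<open>The diagonal gives the squares. Each order of the pair gives at most the edge sum, with
  factor 3, hence the 6.\<close>

lemma sum_defect_kernel_le:
  assumes "\<And>x. q x \<ge> 0"
  shows "(\<Sum>x\<in>{1..T}. \<Sum>y\<in>{1..T}. q x * q y * defect_kernel E x y)
    \<le> (\<Sum>x\<in>{1..T}. (q x)\<^sup>2) + 6 * (\<Sum>e\<in>#E. q (fst e) * q (snd e))"
proof -
  have diag: "(\<Sum>x\<in>{1..T}. \<Sum>y\<in>{1..T}. q x * q y * of_bool (x = y)) = (\<Sum>x\<in>{1..T}. (q x)\<^sup>2)"
    by (intro sum.cong) (auto simp: power2_eq_square of_bool_def if_distrib[of "(*) _"] cong: if_cong)
  have off: "(\<Sum>x\<in>{1..T}. \<Sum>y\<in>{1..T}. real (count E (x, y)) * (q x * q y)) \<le> (\<Sum>e\<in>#E. q (fst e) * q (snd e))"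
    using assms by (intro sum_count_le_sum_mset) auto
  have off': "(\<Sum>x\<in>{1..T}. \<Sum>y\<in>{1..T}. real (count E (y, x)) * (q y * q x)) \<le> (\<Sum>e\<in>#E. q (fst e) * q (snd e))"
    using off by (subst sum.swap)
  have "(\<Sum>x\<in>{1..T}. \<Sum>y\<in>{1..T}. q x * q y * defect_kernel E x y)
      = (\<Sum>x\<in>{1..T}. \<Sum>y\<in>{1..T}. q x * q y * of_bool (x = y))
      + 3 * (\<Sum>x\<in>{1..T}. \<Sum>y\<in>{1..T}. real (count E (x, y)) * (q x * q y))
      + 3 * (\<Sum>x\<in>{1..T}. \<Sum>y\<in>{1..T}. real (count E (y, x)) * (q y * q x))"
    unfolding sum_distrib_left sum.distrib[symmetric] defect_kernel_def
    by (intro sum.cong refl) (simp add: algebra_simps)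
  then show ?thesis
    using diag off off' by linarith
qed

lemma pa_state_initial: "pa_state m 2 0 (replicate_mset m (2, 1))"
  by (auto simp: pa_state_def out_degree_def filter_mset_replicate_mset split: if_splits)

context pa_parameters
begin

text \<open>Allows comparison with the start \<open>E\<^sub>0\<close> of the round: edges among old
  vertices are untouched, and an in-degree grows by at most one per new edge.\<close>

lemma add_edges_reachable:
  assumes "T \<ge> 2" "pa_state m T 0 E\<^sub>0" "k \<le> m"
  shows "finite (set_pmf (add_edges k \<delta> (Suc T) E\<^sub>0)) \<and>
    (\<forall>E\<in>set_pmf (add_edges k \<delta> (Suc T) E\<^sub>0).
       pa_state m T k E \<and> (\<forall>u v. u \<noteq> Suc T \<longrightarrow> count E (u, v) = count E\<^sub>0 (u, v)) \<and>
       (\<forall>v. in_degree E v \<le> in_degree E\<^sub>0 v + k))"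
  using assms(3)
proof (induction k)
  case 0
  then show ?case using assms by simp
next
  case (Suc k)
  let ?A = "set_pmf (add_edges k \<delta> (Suc T) E\<^sub>0)"
  have IH: "finite ?A"
    "\<And>E. E \<in> ?A \<Longrightarrow> pa_state m T k E \<and> (\<forall>u v. u \<noteq> Suc T \<longrightarrow> count E (u, v) = count E\<^sub>0 (u, v)) \<and>
       (\<forall>v. in_degree E v \<le> in_degree E\<^sub>0 v + k)"
    using Suc by auto
  have step: "set_pmf (add_edge \<delta> (Suc T) E) = (\<lambda>x. add_mset (Suc T, x) E) ` {1..T}" if "E \<in> ?A" for E
    using IH(2)[OF that] Suc.prems assms(1) by (intro set_pmf_add_edge[where k = k]) auto
  have "pa_state m T (Suc k) E' \<and> (\<forall>u v. u \<noteq> Suc T \<longrightarrow> count E' (u, v) = count E\<^sub>0 (u, v)) \<and>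
       (\<forall>v. in_degree E' v \<le> in_degree E\<^sub>0 v + Suc k)"
    if "E' \<in> set_pmf (add_edges (Suc k) \<delta> (Suc T) E\<^sub>0)" for E'
  proof -
    obtain E x where E: "E \<in> ?A" "x \<in> {1..T}" "E' = add_mset (Suc T, x) E"
      using \<open>E' \<in> _\<close> step by auto
    show ?thesis
      using IH(2)[OF E(1)] pa_state_add_edge[of m T k E x] E(2)
      unfolding E(3) by (auto simp: in_degree_add_mset le_SucI)
  qed
  moreover have "finite (set_pmf (add_edges (Suc k) \<delta> (Suc T) E\<^sub>0))"
    using IH(1) step by simp
  ultimately show ?case by blast
qed

lemma pa_graph_state:
  assumes "T \<ge> 2"
  shows "finite (set_pmf (pa_graph T \<delta> m)) \<and> (\<forall>E\<in>set_pmf (pa_graph T \<delta> m). pa_state m T 0 E)"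
  using assms
proof (induction T rule: dec_induct)
  case base
  then show ?case
    using pa_state_initial[of m] by (simp add: numeral_2_eq_2)
next
  case (step T)
  have "pa_state m (Suc T) 0 E" if "E \<in> set_pmf (pa_graph (Suc T) \<delta> m)" for E
    using that step add_edges_reachable[of T _ m] by (intro pa_state_Suc) auto
  moreover have "finite (set_pmf (pa_graph (Suc T) \<delta> m))"
    using step add_edges_reachable[of T _ m] by auto
  ultimately show ?case by blast
qed

lemma expectation_add_edges_le:
  assumes "T \<ge> 2" "pa_state m T 0 E\<^sub>0" "k < m"
    and "\<And>E. E \<in> set_pmf (add_edges k \<delta> (Suc T) E\<^sub>0) \<Longrightarrow>
      measure_pmf.expectation (add_edge \<delta> (Suc T) E) h \<le> (g E :: real)"
  shows "measure_pmf.expectation (add_edges (Suc k) \<delta> (Suc T) E\<^sub>0) h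
    \<le> measure_pmf.expectation (add_edges k \<delta> (Suc T) E\<^sub>0) g"
  unfolding add_edges.simps
  using assms add_edges_reachable[OF assms(1,2), of k] finite_set_pmf_add_edge[OF assms(1)]
  by (intro expectation_bind_le) auto

lemma integrable_add_edges:
  assumes "T \<ge> 2" "pa_state m T 0 E\<^sub>0" "k \<le> m"
  shows "integrable (measure_pmf (add_edges k \<delta> (Suc T) E\<^sub>0)) (h :: _ \<Rightarrow> real)"
  using add_edges_reachable[OF assms] by (intro integrable_measure_pmf_finite) auto

text \<open>Iterates the affine bound; since \<open>r \<ge> 1\<close>, each constant
  \<open>c\<close> is majorised by its multiple with the full power of \<open>r\<close>.\<close>

lemma add_edges_growth:
  assumes T: "T \<ge> 2" "pa_state m T 0 E\<^sub>0" and "r \<ge> 1" "c \<ge> 0" "k \<le> m"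
    and growth: "\<And>E j. j < m \<Longrightarrow> pa_state m T j E \<Longrightarrow>
      measure_pmf.expectation (add_edge \<delta> (Suc T) E) h \<le> r * h E + (c :: real)"
  shows "measure_pmf.expectation (add_edges k \<delta> (Suc T) E\<^sub>0) h \<le> r ^ k * (h E\<^sub>0 + real k * c)"
  using \<open>k \<le> m\<close>
proof (induction k)
  case (Suc k)
  have "measure_pmf.expectation (add_edges (Suc k) \<delta> (Suc T) E\<^sub>0) h
      \<le> measure_pmf.expectation (add_edges k \<delta> (Suc T) E\<^sub>0) (\<lambda>E. r * h E + c)"
    using add_edges_reachable[OF T, of k] Suc.prems
    by (intro expectation_add_edges_le T growth) auto
  also have "\<dots> = r * measure_pmf.expectation (add_edges k \<delta> (Suc T) E\<^sub>0) h + c"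
    using integrable_add_edges[OF T, of k] Suc.prems by simp
  also have "\<dots> \<le> r * (r ^ k * (h E\<^sub>0 + real k * c)) + r ^ Suc k * c"
    using Suc \<open>r \<ge> 1\<close> \<open>c \<ge> 0\<close> one_le_power[OF \<open>r \<ge> 1\<close>, of "Suc k"] 
      mult_right_mono[of 1 "r ^ Suc k" c]
    by (intro add_mono mult_left_mono) auto
  also have "\<dots> = r ^ Suc k * (h E\<^sub>0 + real (Suc k) * c)"
    by (simp add: algebra_simps)
  finally show ?case .
qed simp

text \<open>A new defect arises from two of the \<open>m\<close> new edges, and given the past each
  head is \<open>x\<close> with probability at most \<open>q x\<close>, which depends on
  \<open>E\<^sub>0\<close> only. At most \<open>m\<^sup>2\<close> pairs contribute at most
  \<open>G\<close> each in expectation.\<close>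

lemma add_edges_defect:
  assumes T: "T \<ge> 2" and state: "pa_state m T 0 E\<^sub>0"
  shows "measure_pmf.expectation (add_edges m \<delta> (Suc T) E\<^sub>0) (\<lambda>E. real (defect E))
    \<le> real (defect E\<^sub>0) + 4 * (real m)\<^sup>2 / (total_weight T)\<^sup>2
        * (weight_square_sum m T E\<^sub>0 + 6 * edge_weight_sum m E\<^sub>0)"
proof -
  let ?p = "\<lambda>k. add_edges k \<delta> (Suc T) E\<^sub>0"
  let ?new = "\<lambda>E. {#e \<in># E. fst e = Suc T#}"
  \<comment> \<open>The factor 2 covers the whole round: at most \<open>m\<close> is added to a
    weight that is at least \<open>m\<close> from the start.\<close>
  define q where "q x = 2 / total_weight T * weight m E\<^sub>0 x" for x
  \<comment> \<open>\<open>g y\<close> bounds the expected defect caused by the next edge together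
    with an earlier new edge of head \<open>y\<close>. \<open>G\<close> sums this against the bounds
    \<open>q y\<close>, and \<open>H\<close> sums it over the new edges present.\<close>
  define g where "g y = (\<Sum>x\<in>{1..T}. q x * defect_kernel E\<^sub>0 x y)" for y
  define G where "G = (\<Sum>y\<in>{1..T}. q y * g y)"
  define H where "H E = (\<Sum>e\<in>#?new E. g (snd e))" for E :: multigraph
  have q: "q x \<ge> 0" for x
    using total_weight_pos[OF T] weight_nonneg[of m E\<^sub>0 x] by (simp add: q_def)
  have g: "g y \<ge> 0" for y
    unfolding g_def using q defect_kernel_nonneg by (intro sum_nonneg mult_nonneg_nonneg) auto
  have "G \<ge> 0"
    unfolding G_def using q g by (intro sum_nonneg mult_nonneg_nonneg) auto
  have prob: "edge_prob \<delta> T E x \<le> q x"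
    if "k < m" "E \<in> set_pmf (?p k)" "x \<in> {1..T}" for k E x
  proof -
    have E: "pa_state m T k E" "in_degree E x \<le> in_degree E\<^sub>0 x + k"
      using add_edges_reachable[OF T state, of k] that by auto
    then have "weight m E x \<le> 2 * weight m E\<^sub>0 x"
      using \<open>k < m\<close> by (simp add: weight_def)
    then have "weight m E x / total_weight T \<le> q x"
      using total_weight_pos[OF T] by (simp add: q_def divide_right_mono)
    then show ?thesis
      using edge_prob_le[OF T E(1) _ that(3)] \<open>k < m\<close> by linarith
  qed
  have H_step: "measure_pmf.expectation (add_edge \<delta> (Suc T) E) H \<le> H E + G"
    if "k < m" "E \<in> set_pmf (?p k)" for k E
  proof -
    have E: "pa_state m T k E" "k \<le> m"
      using add_edges_reachable[OF T state, of k] that by auto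
    have "measure_pmf.expectation (add_edge \<delta> (Suc T) E) H
        = (\<Sum>x\<in>{1..T}. edge_prob \<delta> T E x * (H E + g x))"
      unfolding expectation_add_edge[OF T E] by (simp add: H_def add.commute)
    also have "\<dots> = H E + (\<Sum>x\<in>{1..T}. edge_prob \<delta> T E x * g x)"
      by (rule sum_edge_prob_add_const[OF T E])
    also have "\<dots> \<le> H E + G"
      unfolding G_def using prob[OF that] g by (intro add_left_mono sum_mono mult_right_mono) auto
    finally show ?thesis .
  qed
  have defect_step: "measure_pmf.expectation (add_edge \<delta> (Suc T) E) (\<lambda>E. real (defect E)) \<le> real (defect E) + H E"
    if "k < m" "E \<in> set_pmf (?p k)" for k E
  proof -
    have E: "pa_state m T k E" "k \<le> m" and count: "\<And>u v. u \<noteq> Suc T \<Longrightarrow> count E (u, v) = count E\<^sub>0 (u, v)"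
      using add_edges_reachable[OF T state, of k] that by auto
    have "real (defect (add_mset (Suc T, x) E)) \<le> real (defect E) + (\<Sum>e\<in>#?new E. defect_kernel E\<^sub>0 x (snd e))"
      if "x \<in> {1..T}" for x
    proof -
      have "real (defect (add_mset (Suc T, x) E)) \<le> real (defect E + (\<Sum>e\<in>#?new E.
         of_bool (snd e = x) + 3 * (count E (x, snd e) + count E (snd e, x))))"
        using defect_add_edge[OF E(1), of x] that by (intro of_nat_mono) auto
      also have "\<dots> = real (defect E) + (\<Sum>e\<in>#?new E.
         real (of_bool (snd e = x) + 3 * (count E (x, snd e) + count E (snd e, x))))"
        by (simp add: of_nat_sum_mset multiset.map_comp comp_def)
      \<comment> \<open>The counts involve \<open>x\<close> and \<open>snd e\<close>, both old
        vertices, so \<open>E\<close> may be replaced by \<open>E\<^sub>0\<close>.\<close>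
      also have "\<dots> = real (defect E) + (\<Sum>e\<in>#?new E. defect_kernel E\<^sub>0 x (snd e))"
        using pa_state_edge[OF E(1)] that count
        by (intro arg_cong2[where f = "(+)"] arg_cong[where f = sum_mset] image_mset_cong refl)
           (fastforce simp: defect_kernel_def)
      finally show ?thesis .
    qed
    then have "measure_pmf.expectation (add_edge \<delta> (Suc T) E) (\<lambda>E. real (defect E))
        \<le> (\<Sum>x\<in>{1..T}. edge_prob \<delta> T E x * (real (defect E) + (\<Sum>e\<in>#?new E. defect_kernel E\<^sub>0 x (snd e))))"
      unfolding expectation_add_edge[OF T E]
      using edge_prob_nonneg[OF T E] by (intro sum_mono mult_left_mono) auto
    also have "\<dots> = real (defect E) + (\<Sum>x\<in>{1..T}. edge_prob \<delta> T E x * (\<Sum>e\<in>#?new E. defect_kernel E\<^sub>0 x (snd e)))"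
      by (rule sum_edge_prob_add_const[OF T E])
    also have "\<dots> \<le> real (defect E) + (\<Sum>x\<in>{1..T}. q x * (\<Sum>e\<in>#?new E. defect_kernel E\<^sub>0 x (snd e)))"
      using prob[OF that] sum_mset_mono_mem[of "?new E" "\<lambda>_. 0"] defect_kernel_nonneg
      by (intro add_left_mono sum_mono mult_right_mono) auto
    also have "\<dots> = real (defect E) + H E"
      unfolding H_def g_def sum_sum_mset_swap[symmetric] by (simp add: sum_mset_distrib_left)
    finally show ?thesis .
  qed
  have H: "measure_pmf.expectation (?p k) H \<le> real k * G" if "k \<le> m" for k
    using that
  proof (induction k)
    case 0
    have new: "?new E\<^sub>0 = {#}"
      using state unfolding pa_state_def out_degree_def size_eq_0_iff_empty by blast
    have "H E\<^sub>0 = 0"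
      unfolding H_def new by simp
    then show ?case by simp
  next
    case (Suc k)
    have "measure_pmf.expectation (?p (Suc k)) H \<le> measure_pmf.expectation (?p k) (\<lambda>E. H E + G)"
      using Suc.prems H_step[of k] by (intro expectation_add_edges_le T state) auto
    also have "\<dots> = measure_pmf.expectation (?p k) H + G"
      using integrable_add_edges[OF T state, of k] Suc.prems by simp
    finally show ?case
      using Suc by (simp add: algebra_simps)
  qed
  have "measure_pmf.expectation (?p k) (\<lambda>E. real (defect E)) \<le> real (defect E\<^sub>0) + real k * (real m * G)"
    if "k \<le> m" for k
    using that
  proof (induction k)
    case (Suc k)
    have "measure_pmf.expectation (?p (Suc k)) (\<lambda>E. real (defect E))
        \<le> measure_pmf.expectation (?p k) (\<lambda>E. real (defect E) + H E)"
      using Suc.prems defect_step[of k] by (intro expectation_add_edges_le T state) auto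
    also have "\<dots> = measure_pmf.expectation (?p k) (\<lambda>E. real (defect E)) + measure_pmf.expectation (?p k) H"
      using integrable_add_edges[OF T state, of k] Suc.prems by simp
    also have "measure_pmf.expectation (?p k) H \<le> real m * G"
      using H[of k] Suc.prems \<open>G \<ge> 0\<close> mult_right_mono[of "real k" "real m" G] by simp
    finally show ?case
      using Suc by (simp add: algebra_simps)
  qed simp
  from this[of m] have "measure_pmf.expectation (?p m) (\<lambda>E. real (defect E)) \<le> real (defect E\<^sub>0) + (real m)\<^sup>2 * G"
    by (simp add: power2_eq_square mult.assoc)
  \<comment> \<open>\<open>q\<close> is \<open>2 / total_weight T\<close> times the weight, so both
    sums acquire the square of this factor.\<close>
  moreover have "G \<le> 4 / (total_weight T)\<^sup>2 * (weight_square_sum m T E\<^sub>0 + 6 * edge_weight_sum m E\<^sub>0)"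
  proof -
    have "G = (\<Sum>y\<in>{1..T}. \<Sum>x\<in>{1..T}. q x * q y * defect_kernel E\<^sub>0 x y)"
      by (simp add: G_def g_def sum_distrib_left mult_ac)
    also have "\<dots> = (\<Sum>x\<in>{1..T}. \<Sum>y\<in>{1..T}. q x * q y * defect_kernel E\<^sub>0 x y)"
      by (rule sum.swap)
    also have "\<dots> \<le> (\<Sum>x\<in>{1..T}. (q x)\<^sup>2) + 6 * (\<Sum>e\<in>#E\<^sub>0. q (fst e) * q (snd e))"
      using q by (rule sum_defect_kernel_le)
    also have "(\<Sum>x\<in>{1..T}. (q x)\<^sup>2) = 4 / (total_weight T)\<^sup>2 * weight_square_sum m T E\<^sub>0"
      by (simp add: q_def weight_square_sum_def sum_distrib_left power_mult_distrib power_divide)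
    also have "(\<Sum>e\<in>#E\<^sub>0. q (fst e) * q (snd e)) = 4 / (total_weight T)\<^sup>2 * edge_weight_sum m E\<^sub>0"
      unfolding edge_weight_sum_def sum_mset_distrib_left q_def
      by (intro arg_cong[where f = sum_mset] image_mset_cong) (simp add: power2_eq_square)
    finally show ?thesis by (simp add: algebra_simps add_divide_distrib)
  qed
  then have "(real m)\<^sup>2 * G \<le> (real m)\<^sup>2 * (4 / (total_weight T)\<^sup>2 * (weight_square_sum m T E\<^sub>0 + 6 * edge_weight_sum m E\<^sub>0))"
    by (intro mult_left_mono) auto
  ultimately show ?thesis by (simp add: algebra_simps)
qed

end

section \<open>Growth of the expectations\<close>

text \<open>Mean value theorem: for \<open>a \<ge> 1\<close> the derivative
  \<open>a * x powr (a - 1)\<close> is nondecreasing, so its value at \<open>n\<close> is a lower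
  bound.\<close>

lemma powr_Suc_ge:
  assumes "a \<ge> 1" "n > 0"
  shows "real n powr a * (1 + a / real n) \<le> real (Suc n) powr a"
proof -
  have "((\<lambda>x. x powr a) has_real_derivative a * x powr (a - 1)) (at x)" if "real n \<le> x" for x
    using that assms by (auto intro!: derivative_eq_intros)
  then obtain z where z: "real n < z" "real (Suc n) powr a - real n powr a = (real (Suc n) - real n) * (a * z powr (a - 1))"
    using MVT2[of "real n" "real (Suc n)" "\<lambda>x. x powr a" "\<lambda>x. a * x powr (a - 1)"] by auto
  have "real n powr (a - 1) \<le> z powr (a - 1)"
    using z(1) assms by (intro powr_mono2) auto
  then have "a * real n powr (a - 1) \<le> a * z powr (a - 1)"
    using assms by (intro mult_left_mono) auto
  moreover have "real n powr a = real n * real n powr (a - 1)"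
    using assms by (simp add: powr_diff)
  ultimately show ?thesis
    using z(2) assms by (simp add: field_simps)
qed

text \<open>Compare with \<open>C * n powr a - D * n\<close>: the subtracted linear term absorbs the
  constant \<open>c\<close>, as \<open>a > 1\<close>.\<close>

lemma linear_recursion_growth:
  fixes x :: "nat \<Rightarrow> real"
  assumes a: "a > 1" and rec: "eventually (\<lambda>n. x (Suc n) \<le> (1 + a / real n) * x n + c) sequentially"
  shows "\<exists>C. eventually (\<lambda>n. x n \<le> C * real n powr a) sequentially"
proof -
  obtain n\<^sub>0 where n0: "n\<^sub>0 > 0" "\<And>n. n \<ge> n\<^sub>0 \<Longrightarrow> x (Suc n) \<le> (1 + a / real n) * x n + c"
    using eventually_conj[OF rec eventually_gt_at_top[of 0]]
    by (auto simp: eventually_sequentially)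
  \<comment> \<open>Chosen with \<open>(a - 1) * D = \<bar>c\<bar>\<close>; \<open>C\<close> then
    makes the comparison hold at \<open>n\<^sub>0\<close>.\<close>
  define D where "D = \<bar>c\<bar> / (a - 1)"
  define C where "C = (\<bar>x n\<^sub>0\<bar> + D * real n\<^sub>0) / real n\<^sub>0 powr a"
  have "(a - 1) * D = \<bar>c\<bar>"
    using a by (simp add: D_def)
  then have D: "D \<ge> 0" "c + D \<le> a * D"
    using a by (simp add: D_def, simp add: left_diff_distrib)
  have C: "C \<ge> 0"
    using D by (auto simp: C_def)
  have "x n \<le> C * real n powr a - D * real n" if "n \<ge> n\<^sub>0" for n
    using that
  proof (induction n rule: dec_induct)
    case base
    then show ?case using n0(1) by (simp add: C_def)
  next
    case (step n)
    then have n: "real n > 0" using n0(1) by simp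
    have "x (Suc n) \<le> (1 + a / real n) * x n + c"
      using n0(2) step by simp
    also have "\<dots> \<le> (1 + a / real n) * (C * real n powr a - D * real n) + c"
      using step a n by (intro add_right_mono mult_left_mono) auto
    also have "\<dots> = C * (real n powr a * (1 + a / real n)) - D * real n - a * D + c"
      using n by (simp add: field_simps)
    also have "\<dots> \<le> C * real (Suc n) powr a - D * real n - a * D + c"
      using powr_Suc_ge[of a n] a n C by (intro add_right_mono diff_right_mono mult_left_mono) auto
    also have "\<dots> \<le> C * real (Suc n) powr a - D * real (Suc n)"
      using D by (simp add: algebra_simps)
    finally show ?case .
  qed
  then have "eventually (\<lambda>n. x n \<le> C * real n powr a) sequentially"
    using D by (intro eventually_sequentiallyI[of n\<^sub>0]) (smt (verit) mult_nonneg_nonneg of_nat_0_le_iff)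
  then show ?thesis by blast
qed

text \<open>The power is at most \<open>exp (m * b / (\<alpha> * n - \<beta>))\<close>, and
  \<open>n\<close> times the excess of this over 1 tends to
  \<open>m * b / \<alpha> < a\<close>.\<close>

lemma product_factor_le:
  fixes b \<alpha> \<beta> a :: real
  assumes "\<alpha> > 0" "b > 0" "real m * b / \<alpha> < a"
  shows "eventually (\<lambda>n. (1 + b / (\<alpha> * real n - \<beta>)) ^ m \<le> 1 + a / real n) sequentially"
proof -
  define M where "M = real m * b"
  have "(\<lambda>n. real n * (exp (M / (\<alpha> * real n - \<beta>)) - 1)) \<longlonglongrightarrow> M * inverse \<alpha>"
    using assms(1) by real_asymp
  then have ev: "eventually (\<lambda>n. real n * (exp (M / (\<alpha> * real n - \<beta>)) - 1) < a) sequentially"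
    using assms(3) by (intro order_tendstoD) (auto simp: M_def divide_inverse)
  have "filterlim (\<lambda>n. \<alpha> * real n - \<beta>) at_top sequentially"
    using assms(1) by real_asymp
  then have ev': "eventually (\<lambda>n. \<alpha> * real n - \<beta> > 0) sequentially"
    unfolding filterlim_at_top_dense by (rule spec)
  show ?thesis
    using ev ev' eventually_gt_at_top[of 0]
  proof eventually_elim
    case (elim n)
    let ?y = "b / (\<alpha> * real n - \<beta>)"
    have "(1 + ?y) ^ m \<le> exp ?y ^ m"
      using elim assms(2) by (intro power_mono) (auto simp: exp_ge_add_one_self)
    also have "\<dots> = exp (M / (\<alpha> * real n - \<beta>))"
      by (simp add: M_def flip: exp_of_nat_mult)
    also have "\<dots> \<le> 1 + a / real n"
      using elim by (simp add: field_simps)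
    finally show ?case .
  qed
qed

text \<open>Increments are eventually below \<open>\<epsilon> / 2\<close>; the other half of
  \<epsilon> absorbs the value at the starting index.\<close>

lemma smallo_of_increments:
  fixes d e :: "nat \<Rightarrow> real"
  assumes "\<And>n. d n \<ge> 0" "eventually (\<lambda>n. d (Suc n) \<le> d n + e n) sequentially" "e \<longlonglongrightarrow> 0"
  shows "d \<in> o(\<lambda>n. real n)"
proof (rule landau_o.smallI)
  fix \<epsilon> :: real assume \<epsilon>: "\<epsilon> > 0"
  have "eventually (\<lambda>n. e n < \<epsilon> / 2) sequentially"
    using assms(3) \<epsilon> by (intro order_tendstoD) auto
  with assms(2) have "eventually (\<lambda>n. d (Suc n) \<le> d n + \<epsilon> / 2) sequentially"
    by eventually_elim auto
  then obtain n\<^sub>0 where n0: "\<And>n. n \<ge> n\<^sub>0 \<Longrightarrow> d (Suc n) \<le> d n + \<epsilon> / 2"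
    by (auto simp: eventually_sequentially)
  have bound: "d n \<le> d n\<^sub>0 + \<epsilon> / 2 * (real n - real n\<^sub>0)" if "n \<ge> n\<^sub>0" for n
    using that
  proof (induction n rule: dec_induct)
    case (step n)
    then show ?case using n0[of n] by (simp add: algebra_simps add_divide_distrib diff_divide_distrib)
  qed simp
  have "eventually (\<lambda>n. real n \<ge> d n\<^sub>0 * 2 / \<epsilon>) sequentially"
    using filterlim_real_sequentially by (simp add: filterlim_at_top)
  then show "eventually (\<lambda>n. norm (d n) \<le> \<epsilon> * norm (real n)) sequentially"
    using eventually_ge_at_top[of n\<^sub>0]
  proof eventually_elim
    case (elim n)
    then have "d n\<^sub>0 \<le> \<epsilon> / 2 * real n"
      using \<epsilon> by (simp add: field_simps)
    moreover have "\<epsilon> / 2 * (real n - real n\<^sub>0) \<le> \<epsilon> / 2 * real n"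
      using \<epsilon> by (intro mult_left_mono) auto
    ultimately show ?case
      using bound[OF elim(2)] assms(1)[of n] by simp
  qed
qed

section \<open>Mean potential and mean defect\<close>

context pa_parameters
begin

definition potential :: "real \<Rightarrow> nat \<Rightarrow> multigraph \<Rightarrow> real" where
  "potential K T E = edge_weight_sum m E + K * weight_square_sum m T E"

lemma edge_weight_sum_nonneg: "edge_weight_sum m E \<ge> 0"
  unfolding edge_weight_sum_def
  using sum_mset_mono_mem[of E "\<lambda>_. 0" "\<lambda>e. weight m E (fst e) * weight m E (snd e)"] weight_nonneg
  by simp

lemma weight_square_sum_nonneg: "weight_square_sum m T E \<ge> 0"
  by (simp add: weight_square_sum_def sum_nonneg)

lemma potential_nonneg: "K \<ge> 0 \<Longrightarrow> potential K T E \<ge> 0"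
  using edge_weight_sum_nonneg weight_square_sum_nonneg by (simp add: potential_def)

text \<open>The square sum feeding the edge sum with factor \<open>m\<close> is \<open>m / K\<close>
  times its share of the potential, so both sums grow at most at the common rate
  \<open>2 + m / K\<close>.\<close>

lemma expectation_potential_add_edge:
  assumes "T \<ge> 2" "pa_state m T k E" "k \<le> m" "K > 0"
  shows "measure_pmf.expectation (add_edge \<delta> (Suc T) E) (potential K T)
    \<le> (1 + (2 + real m / K) / total_weight T) * potential K T E + (real m + K)"
proof -
  have "measure_pmf.expectation (add_edge \<delta> (Suc T) E) (potential K T)
      = measure_pmf.expectation (add_edge \<delta> (Suc T) E) (edge_weight_sum m)
      + K * measure_pmf.expectation (add_edge \<delta> (Suc T) E) (weight_square_sum m T)"
    unfolding potential_def using finite_set_pmf_add_edge[OF assms(1-3)]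
    by (simp add: integrable_measure_pmf_finite)
  also have "\<dots> \<le> (edge_weight_sum m E + 2 * edge_weight_sum m E / total_weight T
      + real m * weight_square_sum m T E / total_weight T + real m)
      + K * (weight_square_sum m T E + 2 * weight_square_sum m T E / total_weight T + 1)"
    using expectation_edge_weight_sum[OF assms(1-3)] expectation_weight_square_sum[OF assms(1-3)] assms(4)
    by (intro add_mono mult_left_mono) auto
  also have "\<dots> = (1 + (2 + real m / K) / total_weight T) * potential K T E + (real m + K)
      - real m / K * edge_weight_sum m E / total_weight T"
    using assms(4) total_weight_pos[OF assms(1)] by (simp add: potential_def field_simps)
  also have "\<dots> \<le> (1 + (2 + real m / K) / total_weight T) * potential K T E + (real m + K)"
    using assms(4) total_weight_pos[OF assms(1)] edge_weight_sum_nonneg by simp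
  finally show ?thesis .
qed

definition mean_potential :: "real \<Rightarrow> nat \<Rightarrow> real" where
  "mean_potential K T = measure_pmf.expectation (pa_graph T \<delta> m) (potential K T)"

definition mean_defect :: "nat \<Rightarrow> real" where
  "mean_defect T = measure_pmf.expectation (pa_graph T \<delta> m) (\<lambda>E. real (defect E))"

lemma integrable_pa_graph:
  "T \<ge> 2 \<Longrightarrow> integrable (measure_pmf (pa_graph T \<delta> m)) (h :: _ \<Rightarrow> real)"
  using pa_graph_state[of T] by (intro integrable_measure_pmf_finite) auto

lemma expectation_pa_graph_Suc_le:
  assumes "T \<ge> 2"
    and "\<And>E. pa_state m T 0 E \<Longrightarrow> measure_pmf.expectation (add_edges m \<delta> (Suc T) E) h \<le> (g E :: real)"
  shows "measure_pmf.expectation (pa_graph (Suc T) \<delta> m) h \<le> measure_pmf.expectation (pa_graph T \<delta> m) g"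
  using assms pa_graph_state[of T] add_edges_reachable[OF assms(1), of _ m]
  by (auto intro!: expectation_bind_le)

lemma mean_potential_Suc:
  assumes "T \<ge> 2" "K > 0"
  shows "mean_potential K (Suc T)
    \<le> (1 + (2 + real m / K) / total_weight T) ^ m * (mean_potential K T + real m * (real m + K)) + K * (real m)\<^sup>2"
proof -
  let ?r = "1 + (2 + real m / K) / total_weight T"
  have r: "?r \<ge> 1"
    using assms total_weight_pos[OF assms(1)] by simp
  have "measure_pmf.expectation (add_edges m \<delta> (Suc T) E) (potential K (Suc T))
      \<le> ?r ^ m * (potential K T E + real m * (real m + K)) + K * (real m)\<^sup>2"
    if E: "pa_state m T 0 E" for E
  proof -
    \<comment> \<open>Passing to \<open>Suc T\<close> admits the new vertex to the square sum, with
      weight \<open>m\<close>.\<close>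
    have "potential K (Suc T) E' = potential K T E' + K * (real m)\<^sup>2"
      if "E' \<in> set_pmf (add_edges m \<delta> (Suc T) E)" for E'
    proof -
      have "in_degree E' (Suc T) = 0"
        using add_edges_reachable[OF assms(1) E, of m] that by (intro pa_state_in_degree_new[of m T m]) auto
      then show ?thesis
        by (simp add: potential_def weight_square_sum_def weight_def algebra_simps)
    qed
    then have "measure_pmf.expectation (add_edges m \<delta> (Suc T) E) (potential K (Suc T))
        = measure_pmf.expectation (add_edges m \<delta> (Suc T) E) (\<lambda>E'. potential K T E' + K * (real m)\<^sup>2)"
      by (intro integral_cong_AE) (auto simp: AE_measure_pmf_iff)
    also have "\<dots> = measure_pmf.expectation (add_edges m \<delta> (Suc T) E) (potential K T) + K * (real m)\<^sup>2"
      using integrable_add_edges[OF assms(1) E, of m] by simp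
    also have "measure_pmf.expectation (add_edges m \<delta> (Suc T) E) (potential K T)
        \<le> ?r ^ m * (potential K T E + real m * (real m + K))"
      using expectation_potential_add_edge[OF assms(1) _ _ assms(2)] assms r
      by (intro add_edges_growth E) auto
    finally show ?thesis by simp
  qed
  then have "mean_potential K (Suc T) \<le> measure_pmf.expectation (pa_graph T \<delta> m)
      (\<lambda>E. ?r ^ m * (potential K T E + real m * (real m + K)) + K * (real m)\<^sup>2)"
    unfolding mean_potential_def using assms(1) by (intro expectation_pa_graph_Suc_le)
  also have "\<dots> = ?r ^ m * (mean_potential K T + real m * (real m + K)) + K * (real m)\<^sup>2"
    unfolding mean_potential_def using integrable_pa_graph[OF assms(1)] by simp
  finally show ?thesis .
qed

text \<open>\<open>K \<ge> 1\<close> lets six times the potential dominate the two sums in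
  \<open>add_edges_defect\<close>; hence 24 = 4 * 6.\<close>

lemma mean_defect_Suc:
  assumes "T \<ge> 2" "K \<ge> 1"
  shows "mean_defect (Suc T) \<le> mean_defect T + 24 * (real m)\<^sup>2 / (total_weight T)\<^sup>2 * mean_potential K T"
proof -
  have "measure_pmf.expectation (add_edges m \<delta> (Suc T) E) (\<lambda>E. real (defect E))
      \<le> real (defect E) + 24 * (real m)\<^sup>2 / (total_weight T)\<^sup>2 * potential K T E"
    if E: "pa_state m T 0 E" for E
  proof -
    have "1 * weight_square_sum m T E \<le> K * weight_square_sum m T E"
      using assms(2) weight_square_sum_nonneg by (intro mult_right_mono) auto
    then have "weight_square_sum m T E + 6 * edge_weight_sum m E \<le> 6 * potential K T E"
      using weight_square_sum_nonneg[of T E] by (simp add: potential_def)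
    then have "4 * (real m)\<^sup>2 / (total_weight T)\<^sup>2 * (weight_square_sum m T E + 6 * edge_weight_sum m E)
        \<le> 4 * (real m)\<^sup>2 / (total_weight T)\<^sup>2 * (6 * potential K T E)"
      by (intro mult_left_mono) auto
    then show ?thesis
      using add_edges_defect[OF assms(1) E] by simp
  qed
  then have "mean_defect (Suc T) \<le> measure_pmf.expectation (pa_graph T \<delta> m)
      (\<lambda>E. real (defect E) + 24 * (real m)\<^sup>2 / (total_weight T)\<^sup>2 * potential K T E)"
    unfolding mean_defect_def using assms(1) by (intro expectation_pa_graph_Suc_le)
  also have "\<dots> = mean_defect T + 24 * (real m)\<^sup>2 / (total_weight T)\<^sup>2 * mean_potential K T"
    unfolding mean_defect_def mean_potential_def using integrable_pa_graph[OF assms(1)] by simp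
  finally show ?thesis .
qed

lemma mean_defect_smallo: "mean_defect \<in> o(\<lambda>T. real T)"
proof -
  let ?\<alpha> = "2 * real m + \<delta>"
  \<comment> \<open>Then \<open>m / K = (m + \<delta>) / m\<close> and
    \<open>m * b = 3 * m + \<delta>\<close>, which is below \<open>2 * (2 * m + \<delta>)\<close>
    because \<open>m + \<delta> > 0\<close>; this makes \<open>\<rho> < 2\<close>.\<close>
  define K where "K = (real m)\<^sup>2 / (real m + \<delta>)"
  define b where "b = 2 + real m / K"
  define \<rho> where "\<rho> = real m * b / ?\<alpha>"
  \<comment> \<open>The midpoint of \<open>max 1 \<rho>\<close> and 2, hence strictly between
    them.\<close>
  define a where "a = (max 1 \<rho> + 2) / 2"
  have pos: "real m \<ge> 1" "real m + \<delta> > 0" "?\<alpha> > 0"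
    using m \<delta> by auto
  have "(real m + \<delta>) * 1 \<le> real m * real m"
    using pos \<delta> by (intro mult_mono) auto
  then have K: "K \<ge> 1"
    using pos by (simp add: K_def power2_eq_square)
  have "real m * b = 3 * real m + \<delta>"
    using pos by (simp add: b_def K_def field_simps power2_eq_square)
  then have exponent: "\<rho> < 2"
    unfolding \<rho>_def using pos by (simp only: divide_less_eq) simp
  have b: "b > 0"
    using pos K by (auto simp: b_def intro!: add_pos_nonneg)
  have a: "1 < a" "a < 2" "\<rho> < a"
    using exponent by (auto simp: a_def max_def)
  \<comment> \<open>The factor 3 bounds \<open>1 + a / T\<close>, since \<open>a < 2\<close> and
    \<open>T \<ge> 2\<close>.\<close>
  define c where "c = 3 * (real m * (real m + K)) + K * (real m)\<^sup>2"
  have factor: "eventually (\<lambda>T. (1 + b / total_weight T) ^ m \<le> 1 + a / real T) sequentially"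
    unfolding total_weight_def by (rule product_factor_le[OF pos(3) b a(3)[unfolded \<rho>_def]])
  have nonneg: "mean_potential K T \<ge> 0" for T
    unfolding mean_potential_def using K by (intro Bochner_Integration.integral_nonneg potential_nonneg) auto
  have "eventually (\<lambda>T. mean_potential K (Suc T) \<le> (1 + a / real T) * mean_potential K T + c) sequentially"
    using factor eventually_ge_at_top[of 2]
  proof eventually_elim
    case (elim T)
    have "mean_potential K (Suc T)
        \<le> (1 + b / total_weight T) ^ m * (mean_potential K T + real m * (real m + K)) + K * (real m)\<^sup>2"
      unfolding b_def using elim K by (intro mean_potential_Suc) auto
    also have "\<dots> \<le> (1 + a / real T) * (mean_potential K T + real m * (real m + K)) + K * (real m)\<^sup>2"
      using elim nonneg[of T] K by (intro add_right_mono mult_right_mono) auto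
    also have "\<dots> \<le> (1 + a / real T) * mean_potential K T + c"
    proof -
      have "1 + a / real T \<le> 3"
        using elim a by (simp add: field_simps)
      then have "(1 + a / real T) * (real m * (real m + K)) \<le> 3 * (real m * (real m + K))"
        using K by (intro mult_right_mono) auto
      then show ?thesis by (simp add: c_def distrib_left)
    qed
    finally show ?case .
  qed
  then obtain C where C: "eventually (\<lambda>T. mean_potential K T \<le> C * real T powr a) sequentially"
    using linear_recursion_growth[OF a(1)] by blast
  define e where "e T = 24 * (real m)\<^sup>2 / (total_weight T)\<^sup>2 * mean_potential K T" for T
  \<comment> \<open>The increments are bounded by a multiple of \<open>T powr (a - 2)\<close> for
    large \<open>T\<close>, and \<open>a < 2\<close>.\<close>
  have "(\<lambda>T. 24 * (real m)\<^sup>2 * C * (real T powr a / (?\<alpha> * real T - 2 * real m)\<^sup>2)) \<longlonglongrightarrow> 24 * (real m)\<^sup>2 * C * 0"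
  proof (intro tendsto_mult tendsto_const)
    show "(\<lambda>T. real T powr a / (?\<alpha> * real T - 2 * real m)\<^sup>2) \<longlonglongrightarrow> 0"
      using pos a(2) by real_asymp
  qed
  then have lim: "(\<lambda>T. 24 * (real m)\<^sup>2 * C * (real T powr a / (?\<alpha> * real T - 2 * real m)\<^sup>2)) \<longlonglongrightarrow> 0"
    by simp
  have "e \<longlonglongrightarrow> 0"
  proof (rule tendsto_sandwich[OF _ _ tendsto_const lim])
    show "eventually (\<lambda>T. 0 \<le> e T) sequentially"
      using nonneg by (auto simp: e_def)
    show "eventually (\<lambda>T. e T \<le> 24 * (real m)\<^sup>2 * C * (real T powr a / (?\<alpha> * real T - 2 * real m)\<^sup>2)) sequentially"
      using C
    proof eventually_elim
      case (elim T)
      then have "e T \<le> 24 * (real m)\<^sup>2 / (total_weight T)\<^sup>2 * (C * real T powr a)"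
        unfolding e_def by (intro mult_left_mono) auto
      then show ?case by (simp add: total_weight_def)
    qed
  qed
  moreover have "eventually (\<lambda>T. mean_defect (Suc T) \<le> mean_defect T + e T) sequentially"
    unfolding e_def using mean_defect_Suc[OF _ K] by (intro eventually_sequentiallyI[of 2]) auto
  ultimately show ?thesis
    by (intro smallo_of_increments[of _ e]) (auto simp: mean_defect_def)
qed

section \<open>Betti numbers of the random complex\<close>

lemma betti_pa_clique_complex:
  assumes "T \<ge> 2" "X \<in> set_pmf (pa_clique_complex T \<delta> m)"
  shows "betti 0 X = 1" and "m < 2 * q \<Longrightarrow> betti q X = 0"
proof -
  obtain E where E: "E \<in> set_pmf (pa_graph T \<delta> m)" "X = clique_complex {1..T} (simple_edges E)"
    using assms(2) by (auto simp: pa_clique_complex_def)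
  then have "pa_state m T 0 E"
    using pa_graph_state[OF assms(1)] by blast
  then show "betti 0 X = 1" and "m < 2 * q \<Longrightarrow> betti q X = 0"
    using betti_0_pa_state[of m T E] betti_eq_0_pa_state[of m T E q] m assms(1) E(2) by auto
qed

text \<open>Replacing \<open>(m - 1) * (T - 1)\<close> by \<open>(m - 1) * T\<close> costs less than
  \<open>m\<close>; the rest of the deviation is at most the defect.\<close>

lemma expectation_betti_1:
  assumes "T \<ge> 2"
  shows "\<bar>measure_pmf.expectation (pa_clique_complex T \<delta> m) (\<lambda>X. real (betti 1 X)) - (real m - 1) * real T\<bar>
    \<le> real m + mean_defect T"
proof -
  let ?b = "\<lambda>E. real (betti 1 (clique_complex {1..T} (simple_edges E)))"
  let ?E = "measure_pmf.expectation (pa_graph T \<delta> m)"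
  have top: "real ((m - 1) * (T - 1)) = (real m - 1) * real T - (real m - 1)"
  proof -
    have minus_1: "real (m - 1) = real m - 1" "real (T - 1) = real T - 1"
      using m assms by (simp_all add: of_nat_diff)
    show ?thesis
      unfolding of_nat_mult minus_1 by (simp add: algebra_simps)
  qed
  have bounds: "?b E \<le> (real m - 1) * real T - (real m - 1)"
    "(real m - 1) * real T - (real m - 1) - real (defect E) \<le> ?b E"
    if "E \<in> set_pmf (pa_graph T \<delta> m)" for E
  proof -
    have E: "pa_state m T 0 E" using pa_graph_state[OF assms] that by blast
    show "?b E \<le> (real m - 1) * real T - (real m - 1)"
      "(real m - 1) * real T - (real m - 1) - real (defect E) \<le> ?b E"
      using betti_1_pa_state[OF E m] assms unfolding top[symmetric] by linarith+
  qed
  have "?E ?b \<le> ?E (\<lambda>E. (real m - 1) * real T - (real m - 1))"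
    using bounds integrable_pa_graph[OF assms] by (intro integral_mono_AE) (auto simp: AE_measure_pmf_iff)
  moreover have "?E (\<lambda>E. (real m - 1) * real T - (real m - 1) - real (defect E)) \<le> ?E ?b"
    using bounds integrable_pa_graph[OF assms] by (intro integral_mono_AE) (auto simp: AE_measure_pmf_iff)
  moreover have "?E (\<lambda>E. (real m - 1) * real T - (real m - 1) - real (defect E))
      = (real m - 1) * real T - (real m - 1) - mean_defect T"
    unfolding mean_defect_def using integrable_pa_graph[OF assms]
    by (subst Bochner_Integration.integral_diff) auto
  moreover have "mean_defect T \<ge> 0"
    by (simp add: mean_defect_def)
  ultimately show ?thesis
    using m by (simp add: pa_clique_complex_def)
qed

lemma expectation_betti_1_smallo:
  "(\<lambda>T. measure_pmf.expectation (pa_clique_complex T \<delta> m) (\<lambda>X. real (betti 1 X))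
      - (real m - 1) * real T) \<in> o(\<lambda>T. real T)"
proof -
  have "(\<lambda>T. real m + mean_defect T) \<in> o(\<lambda>T. real T)"
  proof (rule sum_in_smallo(1)[OF _ mean_defect_smallo])
    show "(\<lambda>T::nat. real m) \<in> o(\<lambda>T. real T)" by real_asymp
  qed
  moreover have "(\<lambda>T. measure_pmf.expectation (pa_clique_complex T \<delta> m) (\<lambda>X. real (betti 1 X))
      - (real m - 1) * real T) \<in> O(\<lambda>T. real m + mean_defect T)"
  proof (rule bigoI[of _ 1], rule eventually_sequentiallyI[of 2])
    fix T :: nat assume "T \<ge> 2"
    then show "norm (measure_pmf.expectation (pa_clique_complex T \<delta> m) (\<lambda>X. real (betti 1 X)) - (real m - 1) * real T)
        \<le> 1 * norm (real m + mean_defect T)"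
      using order.trans[OF expectation_betti_1 abs_ge_self] by simp
  qed
  ultimately show ?thesis
    by (rule landau_o.big_small_trans[rotated])
qed

end

theorem proposition4:
  fixes m :: nat and \<delta> :: real
  assumes "m > 0" and "\<delta> \<in> {- real m<..<0}"
  shows "(\<forall>T\<ge>2. \<forall>X\<in>set_pmf (pa_clique_complex T \<delta> m). betti 0 X = 1)
    \<and> (\<lambda>T. measure_pmf.expectation (pa_clique_complex T \<delta> m) (\<lambda>X. real (betti 1 X))
             - (real m - 1) * real T) \<in> o(\<lambda>T. real T)
    \<and> (\<forall>q. m < 2 * q \<longrightarrow>
          (\<forall>T\<ge>2. \<forall>X\<in>set_pmf (pa_clique_complex T \<delta> m). betti q X = 0))"
proof -
  interpret pa_parameters m \<delta>
    using assms by unfold_locales auto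
  show ?thesis
    using betti_pa_clique_complex expectation_betti_1_smallo by blast
qed

end
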